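(* Consider problem (P) and the sequences generated by Algorithm 1, both described in the context, and suppose that Assumption 1 (stated in the context) holds. For $k\ge 1$ let $W^k:=(\widehat U^k,\widehat V^k,\overline U^k,\overline V^k,\widehat X^k,\overline X^k)$ and let $\mathcal W^*$ be the set of cluster points of $\{W^k\}$. Then for each $W=(\widehat U,\widehat V,\overline U,\overline V,\widehat X,\overline X)\in\mathcal W^*$, both $(\overline U,\overline V)$ and $(\widehat U,\widehat V)$ are stationary points of problem (P), and $\Phi_{\lambda,\mu}(\overline U,\overline V)=\Phi_{\lambda,\mu}(\widehat U,\widehat V)=\varpi^*$, where $\varpi^*$ is the common limit of the sequences $\{\Phi_{\lambda,\mu}(\overline U^k,\overline V^k)\}$ and $\{\Phi_{\lambda,\mu}(\widehat U^k,\widehat V^k)\}$ (which converge to the same point under Assumption 1).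
   Context: **Notation.** $n\le m$ and $r\in[n]:=\{1,\dots,n\}$ are fixed integers, $\mathbb X_r:=\mathbb R^{n\times r}\times\mathbb R^{m\times r}$, and $l$ stands for $n$ or $m$. $\|\cdot\|_F$ is the Frobenius norm, and $\|\cdot\|$ is the spectral norm of a matrix or the Euclidean norm of a vector. $\mathbb O^{a\times b}$ is the set of $a\times b$ real matrices with orthonormal columns, and $\mathbb O^a:=\mathbb O^{a\times a}$. $Z_i$ is the $i$-th column of a matrix $Z$. Singular values are ordered $\sigma_1(X)\ge\sigma_2(X)\ge\cdots$, $\sigma(X)$ is the vector of singular values, $\Sigma_\kappa(X):={\rm Diag}(\sigma_1(X),\dots,\sigma_\kappa(X))$, and for $X\in\mathbb R^{n\times m}$, $\mathbb O^{n,m}(X):=\{(P,Q)\in\mathbb O^n\times\mathbb O^m : X=P[{\rm Diag}(\sigma(X))\ \ 0]Q^\top\}$. **Problem (P).** Minimize over $(U,V)\in\mathbb X_r$ the function $\Phi_{\lambda,\mu}(U,V):=f(UV^\top)+\lambda[\vartheta(U)+\vartheta(V)]+\frac{\mu}{2}[\|U\|_F^2+\|V\|_F^2]$, where $\lambda,\mu>0$; $f:\mathbb R^{n\times m}\to\mathbb R$ is bounded below and differentiable with $\nabla f$ Lipschitz continuous with modulus $L_f$; $\vartheta(W):=\sum_i\theta(\|W_i\|)$ (sum over all columns of $W$); and $\theta:\mathbb R\to(-\infty,\infty]$ is proper and lower semicontinuous with (C.1) $\theta(0)=0$, $\theta(t)>0$ for $t>0$, $\theta(t)=\infty$ for $t<0$;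 (C.2) $\theta$ is differentiable on $(0,\infty)$ and its proximal mapping has a closed form. **Majorization.** $\widehat\Phi_{\lambda,\mu}(U,V,U',V'):=f(U'V'^\top)+\langle\nabla f(U'V'^\top),UV^\top-U'V'^\top\rangle+\frac{L_f}{2}\|UV^\top-U'V'^\top\|_F^2+\lambda[\vartheta(U)+\vartheta(V)]+\frac{\mu}{2}(\|U\|_F^2+\|V\|_F^2)$. **Algorithm 1.** Parameters $\varrho\in(0,1)$, $\underline{\gamma_1},\underline{\gamma_2}>0$, $\gamma_{1,0},\gamma_{2,0}>0$. Choose $\overline P^0\in\mathbb O^{m\times r}$, $\widehat P^0\in\mathbb O^{n\times r}$, $\overline Q^0=\overline D^0=I_r$, $(\overline U^0,\overline V^0)=(\widehat P^0,\overline P^0)$, $\overline X^0=\overline U^0(\overline V^0)^\top$. For $k=0,1,2,\dots$: 1. $U^{k+1}\in\arg\min_{U\in\mathbb R^{n\times r}}\{\widehat\Phi_{\lambda,\mu}(U,\overline V^k,\overline U^k,\overline V^k)+\frac{\gamma_{1,k}}{2}\|U-\overline U^k\|_F^2\}$. 2. Take a thin SVD $U^{k+1}\overline D^k=\widehat P^{k+1}(\widehat D^{k+1})^2(\widehat Q^{k+1})^\top$ with $\widehat P^{k+1}\in\mathbb O^{n\times r}$, $\widehat Q^{k+1}\in\mathbb O^r$, $(\widehat D^{k+1})^2={\rm Diag}(\sigma(U^{k+1}\overline D^k))$; set $\widehat U^{k+1}:=\widehat P^{k+1}\widehat D^{k+1}$, $\widehat V^{k+1}:=\overline P^k\widehat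 Q^{k+1}\widehat D^{k+1}$, $\widehat X^{k+1}:=\widehat U^{k+1}(\widehat V^{k+1})^\top$. 3. $V^{k+1}\in\arg\min_{V\in\mathbb R^{m\times r}}\{\widehat\Phi_{\lambda,\mu}(\widehat U^{k+1},V,\widehat U^{k+1},\widehat V^{k+1})+\frac{\gamma_{2,k}}{2}\|V-\widehat V^{k+1}\|_F^2\}$. 4. Take a thin SVD $V^{k+1}\widehat D^{k+1}=\overline P^{k+1}(\overline D^{k+1})^2(\overline Q^{k+1})^\top$ with $\overline P^{k+1}\in\mathbb O^{m\times r}$, $\overline Q^{k+1}\in\mathbb O^r$, $(\overline D^{k+1})^2={\rm Diag}(\sigma(V^{k+1}\widehat D^{k+1}))$; set $\overline U^{k+1}:=\widehat P^{k+1}\overline Q^{k+1}\overline D^{k+1}$, $\overline V^{k+1}:=\overline P^{k+1}\overline D^{k+1}$, $\overline X^{k+1}:=\overline U^{k+1}(\overline V^{k+1})^\top$. 5. $\gamma_{1,k+1}=\max(\underline{\gamma_1},\varrho\gamma_{1,k})$, $\gamma_{2,k+1}=\max(\underline{\gamma_2},\varrho\gamma_{2,k})$. ($\widehat D^k,\overline D^k$ are diagonal with nonnegative entries.) **Assumption 1.** For any $\kappa\in[n]$, any $X\in\mathbb R^{n\times m}$ with ${\rm rank}(X)\le\kappa$ and any $(P,Q)\in\mathbb O^{n,m}(X)$, the pair $(\overline U,\overline V)=(P_1[\Sigma_\kappa(X)]^{1/2},Q_1[\Sigma_\kappa(X)]^{1/2})$ satisfies $\vartheta(\overline U)+\vartheta(\overline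 V)=\inf\{\vartheta(U)+\vartheta(V): (U,V)\in\mathbb R^{n\times\kappa}\times\mathbb R^{m\times\kappa},\ X=UV^\top\}$, where $P_1,Q_1$ consist of the first $\kappa$ columns of $P,Q$. **Stationary points.** $\partial$ denotes the limiting (Mordukhovich) subdifferential. Let $\phi(x):=\theta(\|x\|)$ for $x\in\mathbb R^l$. A pair $(U,V)\in\mathbb X_r$ is a stationary point of (P) if $0\in\partial\Phi_{\lambda,\mu}(U,V)$, where $\partial\Phi_{\lambda,\mu}(U,V)$ is the product of $\nabla f(UV^\top)V+\mu U+\lambda[\mathcal U_1\times\cdots\times\mathcal U_r]$ and $[\nabla f(UV^\top)]^\top U+\mu V+\lambda[\mathcal V_1\times\cdots\times\mathcal V_r]$, with $\mathcal U_j=\{\theta'(\|U_j\|)U_j/\|U_j\|\}$ if $U_j\ne0$ and $\mathcal U_j=\partial\phi(0)$ if $U_j=0$, and similarly for $\mathcal V_j$. *)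

theory Defs
  imports "HOL-Analysis.Analysis" "HOL-Library.Multiset"
begin

section \<open>Lower semicontinuity, subdifferentials, cluster points\<close>

definition lsc :: "('a::topological_space \<Rightarrow> ereal) \<Rightarrow> bool" where
  "lsc h \<longleftrightarrow> (\<forall>x. h x \<le> Liminf (at x) h)"

definition proper :: "('a \<Rightarrow> ereal) \<Rightarrow> bool" where
  "proper h \<longleftrightarrow> (\<forall>x. h x \<noteq> -\<infinity>) \<and> (\<exists>x. h x \<noteq> \<infinity>)"

definition frechet_subdiff :: "('a::euclidean_space \<Rightarrow> ereal) \<Rightarrow> 'a \<Rightarrow> 'a set" where
  "frechet_subdiff h x = {v. \<bar>h x\<bar> \<noteq> \<infinity> \<and>
     0 \<le> Liminf (at x) (\<lambda>y. (h y - h x - ereal (v \<bullet> (y - x))) / ereal (norm (y - x)))}"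

text \<open>The limiting (Mordukhovich) subdifferential.\<close>

definition limiting_subdiff :: "('a::euclidean_space \<Rightarrow> ereal) \<Rightarrow> 'a \<Rightarrow> 'a set" where
  "limiting_subdiff h x = {v. \<bar>h x\<bar> \<noteq> \<infinity> \<and>
     (\<exists>xs vs. xs \<longlonglongrightarrow> x \<and> (\<lambda>k. h (xs k)) \<longlonglongrightarrow> h x \<and>
        (\<forall>k. vs k \<in> frechet_subdiff h (xs k)) \<and> vs \<longlonglongrightarrow> v)}"

definition cluster_points :: "(nat \<Rightarrow> 'a::topological_space) \<Rightarrow> 'a set" where
  "cluster_points S = {w. \<exists>s. strict_mono s \<and> (S \<circ> s) \<longlonglongrightarrow> w}"


section \<open>Matrices and singular values\<close>

text \<open>
  An \<open>n \<times> m\<close> real matrix has type \<open>('n, 'm) rmat\<close>; on this type \<open>norm\<close> and \<open>\<bullet>\<close> are the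
  Frobenius norm and inner product. Index types are finite linear orders, so that the
  \<open>k\<close>-th row or column (counted from 1) makes sense.
\<close>

type_synonym ('a, 'b) rmat = "((real, 'b) vec, 'a) vec"

definition pos :: "'i::{finite,linorder} \<Rightarrow> nat" where
  "pos i = card {..i}"

definition nth_col :: "('a::finite, 'i::{finite,linorder}) rmat \<Rightarrow> nat \<Rightarrow> (real, 'a) vec" where
  "nth_col P k = column (THE i. pos i = k) P"

definition orthonormal_cols :: "('a::finite, 'b::finite) rmat \<Rightarrow> bool" where
  "orthonormal_cols P \<longleftrightarrow> transpose P ** P = mat 1"

definition nonneg_diag :: "('b, 'b::finite) rmat \<Rightarrow> bool" where
  "nonneg_diag D \<longleftrightarrow> (\<forall>i j. i \<noteq> j \<longrightarrow> D $ i $ j = 0) \<and> (\<forall>i. 0 \<le> D $ i $ i)"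

text \<open>
  The square roots of the eigenvalues of the (symmetric) matrix \<open>X\<^sup>T X\<close>, in nonincreasing
  order and repeated according to multiplicity. If \<open>X\<close> is \<open>a \<times> b\<close> with \<open>a < b\<close>, the list has
  length \<open>b\<close>, and its last \<open>b - a\<close> entries are zeros beyond the \<open>a\<close> singular values of \<open>X\<close>.
\<close>

definition singular_values :: "('a::finite, 'b::finite) rmat \<Rightarrow> real list" where
  "singular_values X = (let G = transpose X ** X in
     rev (sorted_list_of_multiset
       (\<Sum>c\<in>{c. \<exists>v. v \<noteq> 0 \<and> G *v v = c *\<^sub>R v}.
          replicate_mset (dim {v. G *v v = c *\<^sub>R v}) (sqrt c))))"

definition sv :: "('a::finite, 'b::finite) rmat \<Rightarrow> nat \<Rightarrow> real" where
  "sv X k = singular_values X ! (k - 1)"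

text \<open>The rectangular matrix with diagonal \<open>s 1, s 2, \<dots>\<close>: for \<open>a \<le> b\<close> it is \<open>[Diag(s) 0]\<close>.\<close>

definition rect_diag :: "(nat \<Rightarrow> real) \<Rightarrow> ('a::{finite,linorder}, 'b::{finite,linorder}) rmat" where
  "rect_diag s = (\<chi> i j. if pos i = pos j then s (pos i) else 0)"

definition svd_pairs ::
  "('n::{finite,linorder}, 'm::{finite,linorder}) rmat \<Rightarrow> (('n, 'n) rmat \<times> ('m, 'm) rmat) set"
where
  "svd_pairs X = {(P, Q). orthogonal_matrix P \<and> orthogonal_matrix Q \<and>
     X = P ** rect_diag (sv X) ** transpose Q}"

definition thin_svd ::
  "('l::finite, 'r::{finite,linorder}) rmat \<Rightarrow> ('l, 'r) rmat \<Rightarrow> ('r, 'r) rmat \<Rightarrow> ('r, 'r) rmat \<Rightarrow> bool"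
where
  "thin_svd A P S Q \<longleftrightarrow> orthonormal_cols P \<and> orthogonal_matrix Q \<and>
     S = rect_diag (sv A) \<and> A = P ** S ** transpose Q"


section \<open>The regularizer, the objective and its majorization\<close>

text \<open>
  A matrix is also handled as the family of its columns, indexed by a set \<open>J\<close>. This makes it
  possible to quantify over the number of columns.
\<close>

definition vartheta :: "(real \<Rightarrow> ereal) \<Rightarrow> 'j set \<Rightarrow> ('j \<Rightarrow> 'a::real_normed_vector) \<Rightarrow> ereal" where
  "vartheta \<theta> J W = (\<Sum>j\<in>J. \<theta> (norm (W j)))"

abbreviation vartheta_mat :: "(real \<Rightarrow> ereal) \<Rightarrow> ('l::finite, 'r::finite) rmat \<Rightarrow> ereal" where
  "vartheta_mat \<theta> W \<equiv> vartheta \<theta> UNIV (\<lambda>j. column j W)"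

text \<open>\<open>U V\<^sup>T\<close> for matrices given by their columns.\<close>

definition prod_transpose :: "'j set \<Rightarrow> ('j \<Rightarrow> (real, 'n::finite) vec) \<Rightarrow> ('j \<Rightarrow> (real, 'm::finite) vec) \<Rightarrow> ('n, 'm) rmat"
where
  "prod_transpose J U V = (\<chi> a b. \<Sum>j\<in>J. U j $ a * V j $ b)"

definition theta_cond :: "(real \<Rightarrow> ereal) \<Rightarrow> bool" where
  "theta_cond \<theta> \<longleftrightarrow> proper \<theta> \<and> lsc \<theta> \<and>
     \<theta> 0 = 0 \<and> (\<forall>t>0. \<theta> t > 0) \<and> (\<forall>t<0. \<theta> t = \<infinity>) \<and>
     (\<forall>t>0. \<bar>\<theta> t\<bar> \<noteq> \<infinity> \<and> (\<lambda>s. real_of_ereal (\<theta> s)) differentiable (at t))"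

text \<open>
  The balanced factorizations obtained from an SVD are optimal for \<open>vartheta\<close>, for every number
  \<open>\<kappa>\<close> of columns. The two type arguments carry the dimensions \<open>n\<close> and \<open>m\<close>.
\<close>

definition svd_factorization_optimal ::
  "(real \<Rightarrow> ereal) \<Rightarrow> 'n::{finite,linorder} itself \<Rightarrow> 'm::{finite,linorder} itself \<Rightarrow> bool"
where
  "svd_factorization_optimal \<theta> _ _ \<longleftrightarrow>
     (\<forall>\<kappa>\<in>{1..CARD('n)}. \<forall>X :: ('n, 'm) rmat. rank X \<le> \<kappa> \<longrightarrow>
        (\<forall>(P, Q) \<in> svd_pairs X.
           vartheta \<theta> {1..\<kappa>} (\<lambda>j. sqrt (sv X j) *\<^sub>R nth_col P j)
           + vartheta \<theta> {1..\<kappa>} (\<lambda>j. sqrt (sv X j) *\<^sub>R nth_col Q j)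
           = Inf {vartheta \<theta> {1..\<kappa>} U + vartheta \<theta> {1..\<kappa>} V | U V.
                    X = prod_transpose {1..\<kappa>} U V}))"

definition Phi ::
  "(('n::finite, 'm::finite) rmat \<Rightarrow> real) \<Rightarrow> (real \<Rightarrow> ereal) \<Rightarrow> real \<Rightarrow> real \<Rightarrow>
   ('n, 'r::finite) rmat \<Rightarrow> ('m, 'r) rmat \<Rightarrow> ereal"
where
  "Phi f \<theta> lam mu U V =
     ereal (f (U ** transpose V)) + ereal lam * (vartheta_mat \<theta> U + vartheta_mat \<theta> V)
     + ereal (mu / 2 * ((norm U)\<^sup>2 + (norm V)\<^sup>2))"

text \<open>Here and below \<open>gf\<close> is the gradient of \<open>f\<close>.\<close>

definition Phi_hat ::
  "(('n::finite, 'm::finite) rmat \<Rightarrow> real) \<Rightarrow> (('n, 'm) rmat \<Rightarrow> ('n, 'm) rmat) \<Rightarrow> real \<Rightarrow>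
   (real \<Rightarrow> ereal) \<Rightarrow> real \<Rightarrow> real \<Rightarrow>
   ('n, 'r::finite) rmat \<Rightarrow> ('m, 'r) rmat \<Rightarrow> ('n, 'r) rmat \<Rightarrow> ('m, 'r) rmat \<Rightarrow> ereal"
where
  "Phi_hat f gf L \<theta> lam mu U V U' V' =
     (let X = U ** transpose V; X' = U' ** transpose V' in
      ereal (f X' + gf X' \<bullet> (X - X') + L / 2 * (norm (X - X'))\<^sup>2)
      + ereal lam * (vartheta_mat \<theta> U + vartheta_mat \<theta> V)
      + ereal (mu / 2 * ((norm U)\<^sup>2 + (norm V)\<^sup>2)))"


section \<open>Stationary points\<close>

definition col_subdiff :: "(real \<Rightarrow> ereal) \<Rightarrow> 'a::euclidean_space \<Rightarrow> 'a set" where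
  "col_subdiff \<theta> x =
     (if x = 0 then limiting_subdiff (\<lambda>y. \<theta> (norm y)) 0
      else {(deriv (\<lambda>t. real_of_ereal (\<theta> t)) (norm x) / norm x) *\<^sub>R x})"

definition Phi_subdiff ::
  "(('n::finite, 'm::finite) rmat \<Rightarrow> ('n, 'm) rmat) \<Rightarrow> (real \<Rightarrow> ereal) \<Rightarrow> real \<Rightarrow> real \<Rightarrow>
   ('n, 'r::finite) rmat \<Rightarrow> ('m, 'r) rmat \<Rightarrow> (('n, 'r) rmat \<times> ('m, 'r) rmat) set"
where
  "Phi_subdiff gf \<theta> lam mu U V =
     {gf (U ** transpose V) ** V + mu *\<^sub>R U + lam *\<^sub>R M | M. \<forall>j. column j M \<in> col_subdiff \<theta> (column j U)}
     \<times> {transpose (gf (U ** transpose V)) ** U + mu *\<^sub>R V + lam *\<^sub>R N | N. \<forall>j. column j N \<in> col_subdiff \<theta> (column j V)}"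

text \<open>
  \<open>Phi_subdiff\<close> is the product formula for the limiting subdifferential of \<open>Phi\<close>. As \<open>\<theta>'\<close> is not
  assumed continuous, it may be a proper subset of that subdifferential; a stationary point is
  required to have 0 in both sets.
\<close>

definition stationary_point ::
  "(('n::finite, 'm::finite) rmat \<Rightarrow> real) \<Rightarrow> (('n, 'm) rmat \<Rightarrow> ('n, 'm) rmat) \<Rightarrow> (real \<Rightarrow> ereal) \<Rightarrow>
   real \<Rightarrow> real \<Rightarrow> ('n, 'r::finite) rmat \<Rightarrow> ('m, 'r) rmat \<Rightarrow> bool"
where
  "stationary_point f gf \<theta> lam mu U V \<longleftrightarrow>
     0 \<in> limiting_subdiff (\<lambda>(U, V). Phi f \<theta> lam mu U V) (U, V) \<and>
     0 \<in> Phi_subdiff gf \<theta> lam mu U V"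


section \<open>The alternating majorization-minimization algorithm\<close>

text \<open>
  A run of the algorithm. Suffix \<open>h\<close> stands for a hat and \<open>b\<close> for a bar. The values at index 0
  of \<open>U, V, Uh, Vh, Xh, Dh, Qh\<close> are not used.
\<close>

definition algorithm_run ::
  "(('n::{finite,linorder}, 'm::{finite,linorder}) rmat \<Rightarrow> real) \<Rightarrow>
   (('n, 'm) rmat \<Rightarrow> ('n, 'm) rmat) \<Rightarrow> real \<Rightarrow> (real \<Rightarrow> ereal) \<Rightarrow> real \<Rightarrow> real \<Rightarrow>
   real \<Rightarrow> real \<Rightarrow> real \<Rightarrow> (nat \<Rightarrow> real) \<Rightarrow> (nat \<Rightarrow> real) \<Rightarrow>
   (nat \<Rightarrow> ('n, 'r::{finite,linorder}) rmat) \<Rightarrow> (nat \<Rightarrow> ('m, 'r) rmat) \<Rightarrow>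
   (nat \<Rightarrow> ('n, 'r) rmat) \<Rightarrow> (nat \<Rightarrow> ('r, 'r) rmat) \<Rightarrow> (nat \<Rightarrow> ('r, 'r) rmat) \<Rightarrow>
   (nat \<Rightarrow> ('m, 'r) rmat) \<Rightarrow> (nat \<Rightarrow> ('r, 'r) rmat) \<Rightarrow> (nat \<Rightarrow> ('r, 'r) rmat) \<Rightarrow>
   (nat \<Rightarrow> ('n, 'r) rmat) \<Rightarrow> (nat \<Rightarrow> ('m, 'r) rmat) \<Rightarrow> (nat \<Rightarrow> ('n, 'm) rmat) \<Rightarrow>
   (nat \<Rightarrow> ('n, 'r) rmat) \<Rightarrow> (nat \<Rightarrow> ('m, 'r) rmat) \<Rightarrow> (nat \<Rightarrow> ('n, 'm) rmat) \<Rightarrow> bool"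
where
  "algorithm_run f gf L \<theta> lam mu rho g1low g2low g1 g2
     U V Ph Dh Qh Pb Db Qb Uh Vh Xh Ub Vb Xb \<longleftrightarrow>
     0 < rho \<and> rho < 1 \<and> 0 < g1low \<and> 0 < g2low \<and> 0 < g1 0 \<and> 0 < g2 0 \<and>
     orthonormal_cols (Pb 0) \<and> orthonormal_cols (Ph 0) \<and> Qb 0 = mat 1 \<and> Db 0 = mat 1 \<and>
     Ub 0 = Ph 0 \<and> Vb 0 = Pb 0 \<and> Xb 0 = Ub 0 ** transpose (Vb 0) \<and>
     (\<forall>k.
       is_arg_min
         (\<lambda>W. Phi_hat f gf L \<theta> lam mu W (Vb k) (Ub k) (Vb k)
              + ereal (g1 k / 2 * (norm (W - Ub k))\<^sup>2))
         (\<lambda>_. True) (U (Suc k)) \<and>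
       nonneg_diag (Dh (Suc k)) \<and>
       thin_svd (U (Suc k) ** Db k) (Ph (Suc k)) (Dh (Suc k) ** Dh (Suc k)) (Qh (Suc k)) \<and>
       Uh (Suc k) = Ph (Suc k) ** Dh (Suc k) \<and>
       Vh (Suc k) = Pb k ** Qh (Suc k) ** Dh (Suc k) \<and>
       Xh (Suc k) = Uh (Suc k) ** transpose (Vh (Suc k)) \<and>
       is_arg_min
         (\<lambda>W. Phi_hat f gf L \<theta> lam mu (Uh (Suc k)) W (Uh (Suc k)) (Vh (Suc k))
              + ereal (g2 k / 2 * (norm (W - Vh (Suc k)))\<^sup>2))
         (\<lambda>_. True) (V (Suc k)) \<and>
       nonneg_diag (Db (Suc k)) \<and>
       thin_svd (V (Suc k) ** Dh (Suc k)) (Pb (Suc k)) (Db (Suc k) ** Db (Suc k)) (Qb (Suc k)) \<and>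
       Ub (Suc k) = Ph (Suc k) ** Qb (Suc k) ** Db (Suc k) \<and>
       Vb (Suc k) = Pb (Suc k) ** Db (Suc k) \<and>
       Xb (Suc k) = Ub (Suc k) ** transpose (Vb (Suc k)) \<and>
       g1 (Suc k) = max g1low (rho * g1 k) \<and>
       g2 (Suc k) = max g2low (rho * g2 k))"

end

theory Submission
  imports Defs
begin

text \<open>
  Both half steps end with a \<^emph>\<open>balanced\<close> pair: \<open>U = P Diag(d)\<close> and \<open>V = Q Diag(d)\<close> where \<open>P\<close>, \<open>Q\<close> have
  orthonormal columns and \<open>d\<close> is nonnegative and nonincreasing, so that \<open>d\<^sup>2\<close> lists the leading
  singular values of \<open>X = U V\<^sup>T\<close>. The proof combines descent of the objective with three properties of
  such pairs.

  Descent. As \<open>\<nabla>f\<close> is Lipschitz, the model minimized in a half step majorizes the objective, which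
  therefore drops by at least \<open>\<gamma>/2\<close> times the squared step length (\<open>proximal_step_descent\<close>).
  The thin SVD then replaces the factors by a balanced pair with the same product. This does not
  increase the objective (\<open>balanced_objective_le\<close>): the assumed optimality of SVD factorizations
  handles \<open>\<vartheta>\<close>, and \<open>\<parallel>U\<parallel>\<^sup>2 + \<parallel>V\<parallel>\<^sup>2\<close> is at least twice the nuclear norm of the product, with
  equality for balanced pairs. So the objective values of bar, hat and intermediate pairs
  interlace; all converge to one limit \<open>\<omega>\<close>, and the steps tend to zero.

  Passing to the limit. Neither \<open>\<theta>\<close> at \<open>0\<close> nor \<open>\<theta>'\<close> needs to be continuous, so the optimality
  conditions of the iterates cannot be passed to the limit. The minimality inequality can
  (\<open>proximal_step_limit\<close>), because \<open>\<theta>\<close> is nonnegative and continuous away from \<open>0\<close>. A cluster point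
  is thus itself a minimizer of a limiting model, which gives an exact equation for each of its
  nonzero columns, and \<open>\<vartheta>\<close> converges along the subsequence for the factor just updated. The two
  factors of a balanced pair have equal column norms, hence equal \<open>\<vartheta>\<close>, so the whole objective
  converges to its value at the cluster point, which must be \<open>\<omega>\<close>.

  Transfer. The \<open>U\<close>-steps yield only the \<open>U\<close>-equations at the bar pair, the \<open>V\<close>-steps only the
  \<open>V\<close>-equations at the hat pair. As the steps vanish, both pairs factorize the same matrix, so they
  have the same \<open>d\<close>, and for each nonzero singular value their left and right singular vectors are
  related by the same orthogonal change of basis. The weight \<open>\<mu> + \<lambda> \<theta>'(d)/d\<close> in the equations
  depends on the singular value only, so an equation for one pair implies that for the other
  (\<open>balanced_svd_transfer\<close>). Zero columns cause no trouble: \<open>0\<close> is a subgradient of \<open>\<theta>(\<parallel>\<cdot>\<parallel>)\<close> at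
  its minimizer \<open>0\<close>, and both factors of a balanced pair vanish in the same columns.
  \<open>stationary_pointI\<close> turns the column equations into stationarity.
\<close>

section \<open>Positions in a finite linear order\<close>

lemma pos_le_iff: "pos i \<le> pos j \<longleftrightarrow> i \<le> j"
proof
  show "pos i \<le> pos j" if "i \<le> j"
    unfolding pos_def by (rule card_mono) (use that in auto)
  show "i \<le> j" if *: "pos i \<le> pos j"
  proof (rule ccontr)
    assume "\<not> i \<le> j"
    then have "pos j < pos i"
      unfolding pos_def by (intro psubset_card_mono) auto
    with * show False by simp
  qed
qed

lemma pos_eq_iff: "pos i = pos j \<longleftrightarrow> i = j"
  by (metis dual_order.antisym order_refl pos_le_iff)

lemma inj_pos: "inj_on pos A"
  by (simp add: inj_on_def pos_eq_iff)

lemma pos_ge_1: "1 \<le> pos i"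
  by (simp add: pos_def Suc_le_eq card_gt_0_iff)

lemma pos_le_card: "pos (i :: 'i::{finite,linorder}) \<le> CARD('i)"
  unfolding pos_def by (rule card_mono) auto

lemma range_pos: "range (pos :: 'i::{finite,linorder} \<Rightarrow> nat) = {1..CARD('i)}"
proof (rule card_subset_eq)
  show "range (pos :: 'i \<Rightarrow> nat) \<subseteq> {1..CARD('i)}"
    using pos_ge_1 pos_le_card by auto
  show "card (range (pos :: 'i \<Rightarrow> nat)) = card {1..CARD('i)}"
    by (simp add: card_image inj_pos)
qed simp

lemma bij_betw_pos: "bij_betw pos (UNIV :: 'i::{finite,linorder} set) {1..CARD('i)}"
  by (simp add: bij_betw_def inj_pos range_pos)

lemma nth_col_pos: "nth_col P (pos j) = column j P"
  by (simp add: nth_col_def pos_eq_iff)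

text \<open>
  Singular values are read off a sorted list by position, so positions have to be matched with
  indices in sorted order.
\<close>

lemma nth_sorted_list_of_UNIV:
  "sorted_list_of_set (UNIV :: 'i set) ! (pos j - 1) = (j :: 'i::{finite,linorder})"
proof -
  let ?l = "sorted_list_of_set (UNIV :: 'i set)"
  have len: "length ?l = CARD('i)" by simp
  have nth_pos: "pos (?l ! k) = k + 1" if "k < CARD('i)" for k
  proof -
    have "{..?l ! k} = (!) ?l ` {..k}"
    proof (intro set_eqI iffI)
      fix i assume i: "i \<in> {..?l ! k}"
      obtain k' where k': "k' < length ?l" "i = ?l ! k'"
        by (metis UNIV_I finite in_set_conv_nth set_sorted_list_of_set)
      have "k' \<le> k"
      proof (rule ccontr)
        assume "\<not> k' \<le> k"
        then have "?l ! k < ?l ! k'"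
          using sorted_wrt_nth_less[OF strict_sorted_list_of_set[of UNIV], of k k'] k' by simp
        with i k' show False by simp
      qed
      with k' show "i \<in> (!) ?l ` {..k}" by auto
    next
      fix i assume "i \<in> (!) ?l ` {..k}"
      then show "i \<in> {..?l ! k}"
        using sorted_nth_mono[of ?l] that by auto
    qed
    moreover have "inj_on ((!) ?l) {..k}"
      using that by (auto simp: inj_on_def nth_eq_iff_index_eq)
    ultimately show ?thesis by (simp add: pos_def card_image)
  qed
  have "pos j - 1 < CARD('i)" using pos_ge_1[of j] pos_le_card[of j] by linarith
  then have "pos (?l ! (pos j - 1)) = pos j" using nth_pos pos_ge_1[of j] by simp
  then show ?thesis by (simp add: pos_eq_iff)
qed


section \<open>Matrices as families of columns\<close>

lemma inner_columns: "A \<bullet> B = (\<Sum>j\<in>UNIV. column j A \<bullet> column j B)"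
  for A B :: "('a::finite, 'b::finite) rmat"
  unfolding inner_vec_def column_def by simp (rule sum.swap)

lemma norm_sq_columns: "(norm A)\<^sup>2 = (\<Sum>j\<in>UNIV. (norm (column j A))\<^sup>2)"
  for A :: "('a::finite, 'b::finite) rmat"
  by (simp add: power2_norm_eq_inner inner_columns)

lemma inner_transpose: "transpose A \<bullet> transpose B = A \<bullet> B"
  for A B :: "('a::finite, 'b::finite) rmat"
  unfolding inner_vec_def transpose_def by simp (rule sum.swap)

lemma norm_transpose: "norm (transpose A) = norm A"
  for A :: "('a::finite, 'b::finite) rmat"
  by (simp add: norm_eq_sqrt_inner inner_transpose)

lemma column_mult: "column j (A ** B) = A *v column j B"
  for A :: "('a::finite, 'b::finite) rmat" and B :: "('b, 'c::finite) rmat"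
  by (simp add: column_def matrix_matrix_mult_def matrix_vector_mult_def vec_eq_iff)

lemma inner_mult_transpose: "G \<bullet> (W ** transpose V) = (G ** V) \<bullet> W"
  for G :: "('a::finite, 'b::finite) rmat" and V :: "('b, 'c::finite) rmat"
  unfolding inner_vec_def matrix_matrix_mult_def transpose_def
  apply (simp add: sum_distrib_left sum_distrib_right)
  apply (rule sum.cong[OF refl])
  apply (subst sum.swap)
  apply (simp add: mult_ac)
  done

lemma inner_mult_left: "(A ** B) \<bullet> C = B \<bullet> (transpose A ** C)"
  for A :: "('a::finite, 'b::finite) rmat" and B :: "('b, 'c::finite) rmat"
  unfolding inner_columns column_mult 
  by (rule sum.cong[OF refl]) (metis dot_lmul_matrix inner_commute transpose_matrix_vector)

lemma orthonormal_cols_iff: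
  "orthonormal_cols P \<longleftrightarrow> (\<forall>i j. column i P \<bullet> column j P = (if i = j then 1 else 0))"
  by (auto simp: orthonormal_cols_def matrix_mult_transpose_dot_column vec_eq_iff mat_def)

lemma orthonormal_cols_mult:
  assumes "orthonormal_cols P" "orthogonal_matrix Q"
  shows "orthonormal_cols (P ** Q)"
  using assms unfolding orthonormal_cols_def orthogonal_matrix_def
  by (metis matrix_mul_assoc matrix_mul_lid matrix_transpose_mul)

lemma nonneg_diag_mult_column:
  assumes "nonneg_diag D"
  shows "column j (P ** D) = (D $ j $ j) *\<^sub>R column j P"
proof -
  have "D $ k $ j = 0" if "k \<noteq> j" for k using assms that by (simp add: nonneg_diag_def)
  then have "(\<Sum>k\<in>UNIV. P $ i $ k * D $ k $ j) = P $ i $ j * D $ j $ j" for i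
    by (subst sum.remove[of UNIV j]) auto
  then show ?thesis
    by (simp add: column_def matrix_matrix_mult_def vec_eq_iff mult.commute)
qed

lemma nonneg_diag_transpose: "nonneg_diag D \<Longrightarrow> transpose D = D"
  unfolding nonneg_diag_def transpose_def vec_eq_iff by (metis vec_lambda_beta)

lemma mult_transpose_columns:
  "(U ** transpose V) $ a $ b = (\<Sum>j\<in>UNIV. column j U $ a * column j V $ b)"
  by (simp add: matrix_matrix_mult_def transpose_def column_def)

lemma mult_transpose_vec:
  "(U ** transpose V) *v x = (\<Sum>j\<in>UNIV. (column j V \<bullet> x) *\<^sub>R column j U)"
  for U :: "('a::finite, 'c::finite) rmat" and V :: "('b::finite, 'c) rmat"
  unfolding matrix_vector_mult_def vec_eq_iff mult_transpose_columns inner_vec_def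
  by (simp add: sum_distrib_right sum_distrib_left mult_ac sum.swap[of _ "UNIV :: 'c set" "UNIV :: 'b set"])


section \<open>Singular values of a factorized matrix\<close>

text \<open>
  In the orthonormal eigenbasis formed by the columns of \<open>Q\<close>, a vector belongs to the eigenspace of
  \<open>c\<close> exactly if its coordinates at the other eigenvalues vanish.
\<close>

lemma eigenspace_diagonalized:
  fixes Q :: "('b::finite, 'b) rmat"
  assumes Q: "orthogonal_matrix Q"
    and G: "\<And>j. G *v column j Q = d j *\<^sub>R column j Q"
  shows "{v. G *v v = c *\<^sub>R v} = (*v) Q ` {w. \<forall>j. j \<notin> {j. d j = c} \<longrightarrow> w $ j = 0}"
    and "dim {v. G *v v = c *\<^sub>R v} = card {j. d j = c}"
proof -
  have QQ: "transpose Q ** Q = mat 1" "Q ** transpose Q = mat 1"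
    using Q by (auto simp: orthogonal_matrix_def)
  have inj: "inj ((*v) Q)"
    by (rule inj_on_inverseI[of _ "(*v) (transpose Q)"])
      (simp only: matrix_vector_mul_assoc QQ matrix_vector_mul_lid)
  have GQ: "G ** Q = Q ** (\<chi> i j. if i = j then d i else 0)"
  proof -
    have "(\<Sum>k\<in>UNIV. G $ i $ k * Q $ k $ j) = d j * Q $ i $ j" for i j
      using G[of j] by (simp add: vec_eq_iff matrix_vector_mult_def column_def)
    moreover have "(\<Sum>k\<in>UNIV. Q $ i $ k * (if k = j then d k else 0)) = d j * Q $ i $ j" for i j
      by (subst sum.remove[of UNIV j]) auto
    ultimately show ?thesis by (simp add: vec_eq_iff matrix_matrix_mult_def)
  qed
  have diag: "(\<chi> i j. if i = j then d i else 0) *v w = (\<chi> i. d i * w $ i)" for w :: "(real, 'b) vec"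
  proof -
    have "(\<Sum>k\<in>UNIV. (if i = k then d i else 0) * w $ k) = d i * w $ i" for i
      by (subst sum.remove[of UNIV i]) auto
    then show ?thesis by (simp add: matrix_vector_mult_def vec_eq_iff)
  qed
  have iff: "G *v (Q *v w) = c *\<^sub>R (Q *v w) \<longleftrightarrow> (\<forall>j. j \<notin> {j. d j = c} \<longrightarrow> w $ j = 0)" for w
  proof -
    have "G *v (Q *v w) = Q *v (\<chi> i. d i * w $ i)"
      by (simp only: matrix_vector_mul_assoc GQ flip: diag)
    moreover have "c *\<^sub>R (Q *v w) = Q *v (c *\<^sub>R w)"
      by (simp add: matrix_vector_mult_scaleR)
    ultimately have "G *v (Q *v w) = c *\<^sub>R (Q *v w) \<longleftrightarrow> (\<chi> i. d i * w $ i) = c *\<^sub>R w"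
      using inj by (simp add: inj_eq)
    then show ?thesis by (auto simp: vec_eq_iff)
  qed
  show *: "{v. G *v v = c *\<^sub>R v} = (*v) Q ` {w. \<forall>j. j \<notin> {j. d j = c} \<longrightarrow> w $ j = 0}"
  proof (intro set_eqI iffI)
    fix v assume v: "v \<in> {v. G *v v = c *\<^sub>R v}"
    have "v = Q *v (transpose Q *v v)"
      by (simp only: matrix_vector_mul_assoc QQ matrix_vector_mul_lid)
    moreover from v this have "G *v (Q *v (transpose Q *v v)) = c *\<^sub>R (Q *v (transpose Q *v v))"
      by simp
    ultimately show "v \<in> (*v) Q ` {w. \<forall>j. j \<notin> {j. d j = c} \<longrightarrow> w $ j = 0}"
      unfolding iff by blast
  qed (use iff in auto)
  have "dim {w::(real,'b) vec. \<forall>j. j \<notin> {j. d j = c} \<longrightarrow> w $ j = 0} = card {j. d j = c}"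
    using dim_substandard_cart[where 'a=real and d="{j. d j = c}"]
    by (simp add: dim_vec_eq)
  moreover have "dim ((*v) Q ` S) = dim S" for S
    by (rule dim_image_eq) (use inj in \<open>auto simp: inj_on_def\<close>)
  ultimately show "dim {v. G *v v = c *\<^sub>R v} = card {j. d j = c}"
    unfolding * by simp
qed

text \<open>
  Geometric multiplicities count the indices that carry an eigenvalue, so any orthonormal
  diagonalization of \<open>X\<^sup>T X\<close> determines the singular values as a multiset.
\<close>

lemma singular_values_diagonalized:
  fixes X :: "('a::finite, 'b::finite) rmat" and Q :: "('b, 'b) rmat"
  assumes Q: "orthogonal_matrix Q"
    and G: "\<And>j. (transpose X ** X) *v column j Q = d j *\<^sub>R column j Q"
  shows "singular_values X
    = rev (sorted_list_of_multiset (image_mset (\<lambda>j. sqrt (d j)) (mset_set UNIV)))"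
proof -
  let ?G = "transpose X ** X"
  have set: "{c. \<exists>v. v \<noteq> 0 \<and> ?G *v v = c *\<^sub>R v} = range d"
  proof (intro set_eqI iffI)
    fix c assume "c \<in> {c. \<exists>v. v \<noteq> 0 \<and> ?G *v v = c *\<^sub>R v}"
    then obtain v where v: "v \<noteq> 0" "v \<in> {v. ?G *v v = c *\<^sub>R v}" by blast
    then obtain w where w: "v = Q *v w" "\<forall>j. d j \<noteq> c \<longrightarrow> w $ j = 0"
      unfolding eigenspace_diagonalized(1)[OF Q G] by blast
    show "c \<in> range d"
    proof (rule ccontr)
      assume "c \<notin> range d"
      with w(2) have "w = 0" by (auto simp: vec_eq_iff)
      with w(1) v(1) show False by simp
    qed
  next
    fix c assume "c \<in> range d"
    then obtain j where j: "c = d j" by blast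
    have "column j Q \<noteq> 0"
      using Q by (metis norm_zero orthogonal_matrix_orthonormal_columns zero_neq_one)
    then show "c \<in> {c. \<exists>v. v \<noteq> 0 \<and> ?G *v v = c *\<^sub>R v}" using G[of j] j by blast
  qed
  have sing: "(\<Sum>j\<in>A. {#s#}) = replicate_mset (card A) s" if "finite A" for A :: "'b set" and s :: real
    using that by (induction A) auto
  have image: "(\<Sum>j\<in>A. {#g j#}) = image_mset g (mset_set A)" if "finite A" for A :: "'b set" and g :: "'b \<Rightarrow> real"
    using that by (induction A) auto
  have "(\<Sum>c\<in>{c. \<exists>v. v \<noteq> 0 \<and> ?G *v v = c *\<^sub>R v}.
          replicate_mset (dim {v. ?G *v v = c *\<^sub>R v}) (sqrt c))
      = (\<Sum>c\<in>range d. \<Sum>j\<in>{j \<in> UNIV. d j = c}. {#sqrt (d j)#})"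
    unfolding set eigenspace_diagonalized(2)[OF Q G]
    by (rule sum.cong[OF refl]) (simp add: sing)
  also have "\<dots> = (\<Sum>j\<in>UNIV. {#sqrt (d j)#})"
    by (rule sum.image_gen[symmetric]) simp
  also have "\<dots> = image_mset (\<lambda>j. sqrt (d j)) (mset_set UNIV)"
    by (simp add: image)
  finally show ?thesis
    unfolding singular_values_def Let_def by simp
qed

lemma sv_antimono:
  fixes A :: "('a::finite, 'b::{finite,linorder}) rmat" and Q :: "('b, 'b) rmat"
  assumes Q: "orthogonal_matrix Q"
    and G: "\<And>j. (transpose A ** A) *v column j Q = d j *\<^sub>R column j Q"
    and "i \<le> (j :: 'b)"
  shows "sv A (pos j) \<le> sv A (pos i)"
proof -
  let ?l = "sorted_list_of_multiset (image_mset (\<lambda>j. sqrt (d j)) (mset_set UNIV))"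
  have "mset ?l = image_mset (\<lambda>j. sqrt (d j)) (mset_set UNIV)" by simp
  then have "size (mset ?l) = CARD('b)" by (metis size_image_mset size_mset_set)
  then have len: "length ?l = CARD('b)" by (simp only: size_mset)
  have "pos i \<le> pos j" using assms(3) by (simp add: pos_le_iff)
  moreover have "sorted ?l" by simp
  then have "rev ?l ! q \<le> rev ?l ! p" if "p \<le> q" "q < CARD('b)" for p q
    using that len sorted_nth_mono[of ?l "CARD('b) - Suc q" "CARD('b) - Suc p"]
    by (auto simp: rev_nth)
  ultimately show ?thesis
    unfolding sv_def singular_values_diagonalized[OF Q G]
    using pos_ge_1[of j] pos_le_card[of j] by (simp add: diff_le_mono)
qed

lemma sv_eqI:
  fixes X :: "('a::finite, 'b::{finite,linorder}) rmat" and Q :: "('b, 'b) rmat"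
  assumes Q: "orthogonal_matrix Q"
    and G: "\<And>j. (transpose X ** X) *v column j Q = (s j)\<^sup>2 *\<^sub>R column j Q"
    and nonneg: "\<And>j. 0 \<le> s j" and anti: "\<And>i j. i \<le> j \<Longrightarrow> s j \<le> s i"
  shows "sv X (pos j) = s j"
proof -
  let ?l = "sorted_list_of_set (UNIV :: 'b set)"
  have "sorted (rev (map s ?l))"
    unfolding sorted_wrt_rev sorted_wrt_map
    by (rule sorted_wrt_mono_rel[of _ "(\<le>)"]) (auto intro: anti)
  then have "sort (rev (map s ?l)) = rev (map s ?l)" by (rule sorted_sort_id)
  moreover have "mset ?l = mset_set UNIV"
    by (metis mset_sorted_list_of_multiset sorted_list_of_mset_set)
  then have "mset (rev (map s ?l)) = image_mset s (mset_set UNIV)"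
    by simp
  ultimately have "sorted_list_of_multiset (image_mset s (mset_set UNIV)) = rev (map s ?l)"
    by (metis sorted_list_of_multiset_mset)
  then have "singular_values X = map s ?l"
    using singular_values_diagonalized[OF Q G] nonneg by simp
  moreover have "pos j - 1 < CARD('b)" using pos_ge_1[of j] pos_le_card[of j] by linarith
  ultimately show ?thesis using nth_sorted_list_of_UNIV[of j] by (simp add: sv_def)
qed


section \<open>Balanced factorizations\<close>

text \<open>
  The optimality assumption speaks about full orthogonal matrices, while the iterates come from thin
  decompositions. An orthonormal basis of the orthogonal complement supplies the missing columns.
\<close>

lemma orthonormal_cols_extend:
  fixes P :: "('l::{finite,linorder}, 'r::{finite,linorder}) rmat"
  assumes P: "orthonormal_cols P" and le: "CARD('r) \<le> CARD('l)"
  obtains Pt :: "('l, 'l) rmat" where "orthogonal_matrix Pt"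
    "\<And>i j. pos i = pos j \<Longrightarrow> column i Pt = column j P"
proof -
  have on: "column i P \<bullet> column j P = (if i = j then 1 else 0)" for i j
    using P by (simp add: orthonormal_cols_iff)
  let ?S = "range (\<lambda>j. column j P)"
  define W where "W = {x. \<forall>y\<in>?S. orthogonal y x}"
  have inj: "inj (\<lambda>j. column j P)"
    by (rule injI) (metis on zero_neq_one)
  have "pairwise orthogonal ?S"
    using on by (auto simp: pairwise_def orthogonal_def)
  moreover have "0 \<notin> ?S"
    by (metis (mono_tags) imageE inner_zero_left on zero_neq_one)
  ultimately have "independent ?S" by (rule pairwise_orthogonal_independent)
  then have dimS: "dim ?S = CARD('r)"
    by (simp add: dim_eq_card_independent card_image inj)
  have "subspace W"
    unfolding W_def by (rule subspace_orthogonal_to_vectors)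
  moreover have "dim W = CARD('l) - CARD('r)"
  proof -
    have W: "W = {y \<in> UNIV. \<forall>x\<in>span ?S. orthogonal x y}"
    proof (intro set_eqI iffI)
      fix y assume "y \<in> W"
      then have "orthogonal y x" if "x \<in> ?S" for x
        using that by (metis (mono_tags, lifting) W_def mem_Collect_eq orthogonal_commute)
      then have "orthogonal x y" if "x \<in> span ?S" for x
        using orthogonal_to_span[OF that] orthogonal_commute by blast
      then show "y \<in> {y \<in> UNIV. \<forall>x\<in>span ?S. orthogonal x y}" by simp
    qed (simp add: W_def span_base)
    have "dim W + dim (span ?S) = dim (UNIV :: (real, 'l) vec set)"
      unfolding W by (rule dim_subspace_orthogonal_to_vectors) auto
    then show ?thesis by (simp add: dimS)
  qed
  ultimately obtain B where B: "B \<subseteq> W" "pairwise orthogonal B" "\<And>x. x \<in> B \<Longrightarrow> norm x = 1"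
    "independent B" "card B = CARD('l) - CARD('r)"
    by (metis orthonormal_basis_subspace)
  define I where "I = {i :: 'l. CARD('r) < pos i}"
  have "pos ` I = {Suc (CARD('r))..CARD('l)}"
  proof (intro set_eqI iffI)
    fix k assume k: "k \<in> {Suc (CARD('r))..CARD('l)}"
    then have "k \<in> range (pos :: 'l \<Rightarrow> nat)" by (simp add: range_pos)
    with k show "k \<in> pos ` I" by (auto simp: I_def)
  qed (auto simp: I_def pos_le_card)
  then have "card I = CARD('l) - CARD('r)"
    by (metis card_atLeastAtMost card_image diff_Suc_Suc inj_pos)
  moreover have "finite B" using B(4) independent_bound by blast
  ultimately obtain h where h: "bij_betw h I B"
    using B(5) finite_same_card_bij[of I B] by auto
  define g where "g i = (if pos i \<le> CARD('r) then column (inv_into UNIV pos (pos i)) P else h i)"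
    for i :: 'l
  have inv: "pos (inv_into (UNIV :: 'r set) pos (pos i)) = pos i" if "pos i \<le> CARD('r)" for i :: 'l
    by (rule f_inv_into_f) (use that pos_ge_1[of i] in \<open>simp add: range_pos\<close>)
  have hI: "h i \<in> B" if "\<not> pos i \<le> CARD('r)" for i
    using that h by (auto simp: I_def bij_betw_def)
  have norm: "norm (g i) = 1" for i
    using B(3) hI by (simp add: g_def norm_eq_1 on)
  have orth: "orthogonal (g i) (g j)" if "i \<noteq> j" "pos i \<le> pos j" for i j
  proof (cases "pos i \<le> CARD('r)"; cases "pos j \<le> CARD('r)")
    assume *: "pos i \<le> CARD('r)" "pos j \<le> CARD('r)"
    have "pos i \<noteq> pos j" using that by (simp add: pos_eq_iff)
    then have "inv_into (UNIV :: 'r set) pos (pos i) \<noteq> inv_into UNIV pos (pos j)"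
      using inv[OF *(1)] inv[OF *(2)] by metis
    with * show ?thesis by (simp add: g_def orthogonal_def on)
  next
    assume "pos i \<le> CARD('r)" "\<not> pos j \<le> CARD('r)"
    then show ?thesis using hI[of j] B(1) by (auto simp: g_def W_def)
  next
    assume *: "\<not> pos i \<le> CARD('r)" "\<not> pos j \<le> CARD('r)"
    then have "h i \<noteq> h j" using h that by (auto simp: I_def bij_betw_def inj_on_def)
    with * show ?thesis using hI B(2) by (auto simp: g_def pairwise_def)
  qed (use that in auto)
  show ?thesis
  proof
    have "column i (\<chi> a i. g i $ a) = g i" for i by (simp add: column_def)
    moreover have "orthogonal (g i) (g j)" if "i \<noteq> j" for i j
      using orth[of i j] orth[of j i] that by (metis nle_le orthogonal_commute)
    ultimately show "orthogonal_matrix (\<chi> a i. g i $ a)"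
      by (auto simp: orthogonal_matrix_orthonormal_columns norm)
    show "column i (\<chi> a i. g i $ a) = column j P" if "pos i = pos j" for i j
      using that pos_le_card[of j] by (simp add: column_def g_def inj_pos)
  qed
qed

text \<open>
  The relation is stated column by column, without the diagonal matrix, because this form is
  preserved in limits and makes swapping the two factors trivial.
\<close>

definition balanced_svd ::
  "('n::{finite,linorder}, 'r::{finite,linorder}) rmat \<Rightarrow> ('m::{finite,linorder}, 'r) rmat \<Rightarrow>
   ('n, 'r) rmat \<Rightarrow> ('m, 'r) rmat \<Rightarrow> ('r \<Rightarrow> real) \<Rightarrow> bool"
where
  "balanced_svd U V P Q d \<longleftrightarrow> orthonormal_cols P \<and> orthonormal_cols Q \<and>
     (\<forall>j. 0 \<le> d j) \<and> (\<forall>i j. i \<le> j \<longrightarrow> d j \<le> d i) \<and>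
     (\<forall>j. column j U = d j *\<^sub>R column j P) \<and> (\<forall>j. column j V = d j *\<^sub>R column j Q)"

lemma balanced_svd_swap: "balanced_svd U V P Q d \<Longrightarrow> balanced_svd V U Q P d"
  by (simp add: balanced_svd_def)

lemma balanced_svd_singular_vector:
  assumes "balanced_svd U V P Q d"
  shows "(U ** transpose V) *v column j Q = (d j)\<^sup>2 *\<^sub>R column j P"
proof -
  have "(column i V \<bullet> column j Q) *\<^sub>R column i U
      = (if i = j then (d j)\<^sup>2 *\<^sub>R column j P else 0)" for i
    using assms by (auto simp: balanced_svd_def orthonormal_cols_iff power2_eq_square)
  then show ?thesis by (simp add: mult_transpose_vec)
qed

lemma balanced_svd_kernel:
  assumes "balanced_svd U V P Q d" "\<And>j. column j Q \<bullet> x = 0"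
  shows "(U ** transpose V) *v x = 0"
  using assms by (simp add: mult_transpose_vec balanced_svd_def)

lemma balanced_svd_column_norms:
  assumes "balanced_svd U V P Q d"
  shows "norm (column j U) = d j" "norm (column j V) = d j"
  using assms by (auto simp: balanced_svd_def orthonormal_cols_iff norm_eq_sqrt_inner)

text \<open>
  A balanced pair extends to a full singular value decomposition of its product, whose leading
  singular values are the squares of the column norms. This identifies the pair with the
  factorization that is assumed to be optimal.
\<close>

lemma balanced_svd_extend:
  fixes U :: "('n::{finite,linorder}, 'r::{finite,linorder}) rmat"
    and V :: "('m::{finite,linorder}, 'r) rmat"
  assumes dims: "CARD('r) \<le> CARD('n)" "CARD('n) \<le> CARD('m)"
    and bal: "balanced_svd U V P Q d"
  obtains Pt Qt where "(Pt, Qt) \<in> svd_pairs (U ** transpose V)"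
    "\<And>j. nth_col Pt (pos j) = column j P" "\<And>j. nth_col Qt (pos j) = column j Q"
    "\<And>j. sv (U ** transpose V) (pos j) = (d j)\<^sup>2"
proof -
  let ?X = "U ** transpose V"
  obtain Pt :: "('n, 'n) rmat" where Pt: "orthogonal_matrix Pt"
    and Pt_col: "\<And>i j. pos i = pos j \<Longrightarrow> column i Pt = column j P"
    using orthonormal_cols_extend[of P] bal dims by (auto simp: balanced_svd_def)
  obtain Qt :: "('m, 'm) rmat" where Qt: "orthogonal_matrix Qt"
    and Qt_col: "\<And>i j. pos i = pos j \<Longrightarrow> column i Qt = column j Q"
    using orthonormal_cols_extend[of Q] bal dims by (auto simp: balanced_svd_def)
  \<comment> \<open>The empty sum makes the values at positions beyond the number of columns of \<open>U\<close> zero.\<close>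
  define s where "s k = (\<Sum>j\<in>{j::'r. pos j = k}. (d j)\<^sup>2)" for k
  have s_pos: "s (pos j) = (d j)\<^sup>2" for j
  proof -
    have "{j'::'r. pos j' = pos j} = {j}" by (auto simp: pos_eq_iff)
    then show ?thesis by (simp add: s_def)
  qed
  have s_nonneg: "0 \<le> s k" for k
    by (simp add: s_def sum_nonneg)
  have s_zero: "s k = 0" if "k \<notin> range (pos :: 'r \<Rightarrow> nat)" for k
  proof -
    have "{j'::'r. pos j' = k} = {}" using that by auto
    then show ?thesis by (simp only: s_def sum.empty)
  qed
  have X_zero: "?X *v column i Qt = 0" if "pos i \<notin> range (pos :: 'r \<Rightarrow> nat)" for i
  proof (rule balanced_svd_kernel[OF bal])
    fix j :: 'r
    obtain i' :: 'm where i': "pos i' = pos j"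
      using range_pos[where 'i='m] pos_ge_1[of j] pos_le_card[of j] dims
      by (metis (mono_tags, lifting) atLeastAtMost_iff imageE le_trans)
    with that have "i' \<noteq> i" by auto
    then show "column j Q \<bullet> column i Qt = 0"
      using Qt by (auto simp: orthogonal_matrix_orthonormal_columns orthogonal_def
          simp flip: Qt_col[OF i'])
  qed
  have X_pos: "?X *v column i Qt = s (pos i) *\<^sub>R column j P" if "pos i = pos j" for i j
    using balanced_svd_singular_vector[OF bal, of j] Qt_col[OF that] that by (simp add: s_pos)
  have XX: "(transpose ?X ** ?X) *v column i Qt = (s (pos i))\<^sup>2 *\<^sub>R column i Qt" for i
  proof (cases "pos i \<in> range (pos :: 'r \<Rightarrow> nat)")
    case True
    then obtain j :: 'r where j: "pos i = pos j" by auto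
    have T: "transpose ?X *v column j P = s (pos i) *\<^sub>R column i Qt"
      using balanced_svd_singular_vector[OF balanced_svd_swap[OF bal], of j]
      by (simp only: matrix_transpose_mul transpose_transpose s_pos j Qt_col[OF j])
    have "(transpose ?X ** ?X) *v column i Qt = transpose ?X *v (?X *v column i Qt)"
      by (rule matrix_vector_mul_assoc[symmetric])
    then show ?thesis
      unfolding X_pos[OF j] matrix_vector_mult_scaleR T by (simp add: power2_eq_square)
  next
    case False
    have "(transpose ?X ** ?X) *v column i Qt = transpose ?X *v (?X *v column i Qt)"
      by (rule matrix_vector_mul_assoc[symmetric])
    then show ?thesis unfolding X_zero[OF False] s_zero[OF False] by simp
  qed
  have anti: "s (pos i') \<le> s (pos i)" if "i \<le> i'" for i i' :: 'm
  proof (cases "pos i' \<in> range (pos :: 'r \<Rightarrow> nat)")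
    case True
    then obtain j' :: 'r where j': "pos i' = pos j'" by auto
    have "pos i \<in> range (pos :: 'r \<Rightarrow> nat)"
      using j' that pos_ge_1[of i] pos_le_card[of j'] pos_le_iff[of i i'] by (simp add: range_pos)
    then obtain j :: 'r where j: "pos i = pos j" by auto
    have "j \<le> j'" using that j j' by (metis pos_le_iff)
    then have "d j' \<le> d j" "0 \<le> d j'" using bal by (auto simp: balanced_svd_def)
    then show ?thesis by (simp add: s_pos j j' power_mono)
  qed (simp add: s_zero s_nonneg)
  have sv: "sv ?X (pos i) = s (pos i)" for i :: 'm
    by (rule sv_eqI[OF Qt XX]) (auto intro: anti s_nonneg)
  have "?X ** Qt = Pt ** rect_diag (sv ?X)"
  proof -
    have "column i (?X ** Qt) = column i (Pt ** rect_diag (sv ?X))" for i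
    proof (cases "pos i \<in> range (pos :: 'n \<Rightarrow> nat)")
      case True
      then obtain i' :: 'n where i': "pos i = pos i'" by auto
      have "(\<Sum>l\<in>UNIV. Pt $ a $ l * (if pos l = pos i then t (pos l) else 0)) = Pt $ a $ i' * t (pos i)" for a t
        by (subst sum.remove[of UNIV i']) (auto simp: i' pos_eq_iff intro!: sum.neutral)
      then have "column i (Pt ** rect_diag t) = t (pos i) *\<^sub>R column i' Pt" for t
        by (simp add: column_def matrix_matrix_mult_def rect_diag_def vec_eq_iff)
      then have R: "column i (Pt ** rect_diag (sv ?X)) = s (pos i) *\<^sub>R column i' Pt"
        by (simp only: sv)
      show ?thesis
      proof (cases "pos i \<in> range (pos :: 'r \<Rightarrow> nat)")
        case True
        then obtain j :: 'r where j: "pos i = pos j" by auto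
        with i' have "pos i' = pos j" by simp
        then have "column i' Pt = column j P" by (rule Pt_col)
        then show ?thesis
          unfolding R column_mult[of i ?X] X_pos[OF j] by simp
      next
        case False
        then show ?thesis
          unfolding R column_mult[of i ?X] X_zero[OF False] s_zero[OF False] by simp
      qed
    next
      case False
      then have neq: "pos l \<noteq> pos i" for l :: 'n by (metis rangeI)
      have "pos i \<notin> range (pos :: 'r \<Rightarrow> nat)"
        using False dims by (auto simp: range_pos)
      then show ?thesis
        by (simp add: column_mult X_zero)
          (simp add: column_def matrix_matrix_mult_def matrix_vector_mult_def rect_diag_def vec_eq_iff neq)
    qed
    then show ?thesis by (simp add: vec_eq_iff column_def)
  qed
  then have "?X = Pt ** rect_diag (sv ?X) ** transpose Qt"
    using Qt by (metis matrix_mul_assoc matrix_mul_rid orthogonal_matrix_def)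
  then have "(Pt, Qt) \<in> svd_pairs ?X"
    using Pt Qt by (simp add: svd_pairs_def)
  moreover have "nth_col Pt (pos j) = column j P \<and> nth_col Qt (pos j) = column j Q \<and>
      sv ?X (pos j) = (d j)\<^sup>2" for j
  proof -
    have "pos j \<in> range (pos :: 'n \<Rightarrow> nat)" "pos j \<in> range (pos :: 'm \<Rightarrow> nat)"
      using dims pos_ge_1[of j] pos_le_card[of j] by (auto simp: range_pos)
    then obtain i :: 'n and i' :: 'm where i: "pos i = pos j" "pos i' = pos j" by (metis imageE)
    show ?thesis
      using nth_col_pos[of Pt i] nth_col_pos[of Qt i'] Pt_col[OF i(1)] Qt_col[OF i(2)] sv[of i']
      by (simp add: i s_pos)
  qed
  ultimately show ?thesis using that by blast
qed

lemma vartheta_positions: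
  fixes W :: "('l::finite, 'r::{finite,linorder}) rmat"
  assumes "\<And>j. w (pos j) = column j W"
  shows "vartheta \<theta> {1..CARD('r)} w = vartheta_mat \<theta> W"
  unfolding vartheta_def
  by (subst sum.reindex_bij_betw[OF bij_betw_pos, symmetric]) (simp add: assms)

text \<open>
  The optimality assumption indexes columns by \<open>{1..\<kappa>}\<close>; positions translate
  any competing factorization.
\<close>

lemma prod_transpose_positions:
  fixes U :: "('n::finite, 'r::{finite,linorder}) rmat" and V :: "('m::finite, 'r) rmat"
  shows "prod_transpose {1..CARD('r)} (nth_col U) (nth_col V) = U ** transpose V"
  unfolding prod_transpose_def vec_eq_iff mult_transpose_columns
  by (subst sum.reindex_bij_betw[OF bij_betw_pos, symmetric]) (simp add: nth_col_pos)

lemma balanced_svd_vartheta_le: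
  fixes U U' :: "('n::{finite,linorder}, 'r::{finite,linorder}) rmat"
    and V V' :: "('m::{finite,linorder}, 'r) rmat"
  assumes dims: "CARD('r) \<le> CARD('n)" "CARD('n) \<le> CARD('m)"
    and optimal: "svd_factorization_optimal \<theta> TYPE('n) TYPE('m)"
    and bal: "balanced_svd U V P Q d"
    and eq: "U ** transpose V = U' ** transpose V'"
  shows "vartheta_mat \<theta> U + vartheta_mat \<theta> V \<le> vartheta_mat \<theta> U' + vartheta_mat \<theta> V'"
proof -
  let ?X = "U ** transpose V" and ?I = "{1..CARD('r)}"
  obtain Pt Qt where svd: "(Pt, Qt) \<in> svd_pairs ?X"
    and cols: "\<And>j. nth_col Pt (pos j) = column j P" "\<And>j. nth_col Qt (pos j) = column j Q"
    and sv: "\<And>j. sv ?X (pos j) = (d j)\<^sup>2"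
    using balanced_svd_extend[OF dims bal] by blast
  have "rank ?X \<le> rank U" by (rule rank_mul_le_left)
  also have "\<dots> \<le> CARD('r)" using rank_bound[of U] by simp
  finally have "rank ?X \<le> CARD('r)" .
  moreover have "CARD('r) \<in> {1..CARD('n)}" using dims by (simp add: Suc_le_eq)
  ultimately have "vartheta \<theta> ?I (\<lambda>j. sqrt (sv ?X j) *\<^sub>R nth_col Pt j)
      + vartheta \<theta> ?I (\<lambda>j. sqrt (sv ?X j) *\<^sub>R nth_col Qt j)
      = Inf {vartheta \<theta> ?I U + vartheta \<theta> ?I V | U V. ?X = prod_transpose ?I U V}"
    using optimal svd unfolding svd_factorization_optimal_def by blast
  also have "\<dots> \<le> vartheta \<theta> ?I (nth_col U') + vartheta \<theta> ?I (nth_col V')"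
  proof (rule Inf_lower)
    have "?X = prod_transpose ?I (nth_col U') (nth_col V')"
      using eq by (simp only: prod_transpose_positions)
    then show "vartheta \<theta> ?I (nth_col U') + vartheta \<theta> ?I (nth_col V')
        \<in> {vartheta \<theta> ?I U + vartheta \<theta> ?I V | U V. ?X = prod_transpose ?I U V}" by blast
  qed
  also have "\<dots> = vartheta_mat \<theta> U' + vartheta_mat \<theta> V'"
    by (simp only: vartheta_positions nth_col_pos)
  also have "vartheta \<theta> ?I (\<lambda>j. sqrt (sv ?X j) *\<^sub>R nth_col Pt j) = vartheta_mat \<theta> U"
    by (rule vartheta_positions) (use bal in \<open>simp add: cols sv balanced_svd_def\<close>)
  also have "vartheta \<theta> ?I (\<lambda>j. sqrt (sv ?X j) *\<^sub>R nth_col Qt j) = vartheta_mat \<theta> V"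
    by (rule vartheta_positions) (use bal in \<open>simp add: cols sv balanced_svd_def\<close>)
  finally show ?thesis .
qed

text \<open>
  Bessel's inequality, applied to all columns of \<open>W\<close> at once.
\<close>

lemma norm_orthonormal_cols_transpose_le:
  fixes P :: "('l::finite, 'r::finite) rmat" and W :: "('l, 'k::finite) rmat"
  assumes "orthonormal_cols P"
  shows "norm (transpose P ** W) \<le> norm W"
proof -
  let ?Z = "transpose P ** W"
  have "(P ** ?Z) \<bullet> (P ** ?Z) = ?Z \<bullet> (transpose P ** (P ** ?Z))"
    by (rule inner_mult_left)
  also have "transpose P ** (P ** ?Z) = ?Z"
    using assms by (simp only: matrix_mul_assoc orthonormal_cols_def matrix_mul_lid)
  finally have "norm (P ** ?Z) = norm ?Z" by (simp add: norm_eq_sqrt_inner)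
  moreover have "?Z \<bullet> ?Z = (P ** ?Z) \<bullet> W" by (simp add: inner_mult_left)
  ultimately have "norm ?Z * norm ?Z \<le> norm ?Z * norm W"
    by (metis norm_cauchy_schwarz power2_eq_square power2_norm_eq_inner)
  then show ?thesis
    by (cases "norm ?Z = 0") (auto simp: mult_le_cancel_left)
qed

text \<open>
  With \<open>X = U V\<^sup>T\<close> the sum of the \<open>d\<^sub>j\<^sup>2\<close> is the trace of \<open>P\<^sup>T X Q\<close>, which for any factorization
  \<open>X = U' V'\<^sup>T\<close> is the inner product of \<open>P\<^sup>T U'\<close> and \<open>Q\<^sup>T V'\<close>. The arithmetic-geometric mean inequality
  and Bessel's inequality bound it by half of the right-hand side.
\<close>

lemma balanced_svd_norm_le:
  fixes U U' :: "('n::{finite,linorder}, 'r::{finite,linorder}) rmat"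
    and V V' :: "('m::{finite,linorder}, 'r) rmat"
  assumes bal: "balanced_svd U V P Q d"
    and eq: "U ** transpose V = U' ** transpose V'"
  shows "(norm U)\<^sup>2 + (norm V)\<^sup>2 \<le> (norm U')\<^sup>2 + (norm V')\<^sup>2"
proof -
  let ?A = "transpose P ** U'" and ?B = "transpose Q ** V'"
  have PQ: "orthonormal_cols P" "orthonormal_cols Q" using bal by (auto simp: balanced_svd_def)
  have "((U' ** transpose V') ** Q) \<bullet> P = (\<Sum>j\<in>UNIV. (d j)\<^sup>2)"
    using PQ by (simp add: inner_columns column_mult eq[symmetric]
        balanced_svd_singular_vector[OF bal] orthonormal_cols_iff)
  moreover have "(U' ** transpose V') ** Q = U' ** transpose ?B"
    by (simp add: matrix_transpose_mul matrix_mul_assoc)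
  then have "((U' ** transpose V') ** Q) \<bullet> P = (P ** ?B) \<bullet> U'"
    by (metis inner_commute inner_mult_transpose)
  then have "((U' ** transpose V') ** Q) \<bullet> P = ?A \<bullet> ?B"
    by (metis inner_commute inner_mult_left)
  ultimately have "(\<Sum>j\<in>UNIV. (d j)\<^sup>2) = ?A \<bullet> ?B" by simp
  moreover have "2 * (?A \<bullet> ?B) \<le> (norm ?A)\<^sup>2 + (norm ?B)\<^sup>2"
    using inner_ge_zero[of "?A - ?B"]
    by (simp add: power2_norm_eq_inner inner_diff_left inner_diff_right inner_commute)
  moreover have "(norm ?A)\<^sup>2 \<le> (norm U')\<^sup>2" "(norm ?B)\<^sup>2 \<le> (norm V')\<^sup>2"
    using PQ by (auto intro!: power_mono norm_orthonormal_cols_transpose_le)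
  moreover have "(norm U)\<^sup>2 = (\<Sum>j\<in>UNIV. (d j)\<^sup>2)" "(norm V)\<^sup>2 = (\<Sum>j\<in>UNIV. (d j)\<^sup>2)"
    by (auto simp: norm_sq_columns balanced_svd_column_norms[OF bal])
  ultimately show ?thesis by linarith
qed


section \<open>The regularizer and the objective as real functions\<close>

text \<open>
  Norms are nonnegative and \<open>\<theta>\<close> is finite on \<open>[0, \<infinity>)\<close>, so the extended real values never become
  infinite and all estimates can be carried out in the reals.
\<close>

definition reg :: "(real \<Rightarrow> ereal) \<Rightarrow> ('l::finite, 'r::finite) rmat \<Rightarrow> real" where
  "reg \<theta> W = (\<Sum>j\<in>UNIV. real_of_ereal (\<theta> (norm (column j W))))"

definition objective ::
  "(('n::finite, 'm::finite) rmat \<Rightarrow> real) \<Rightarrow> (real \<Rightarrow> ereal) \<Rightarrow> real \<Rightarrow> real \<Rightarrow>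
   ('n, 'r::finite) rmat \<Rightarrow> ('m, 'r) rmat \<Rightarrow> real"
where
  "objective f \<theta> lam mu U V = f (U ** transpose V) + lam * (reg \<theta> U + reg \<theta> V)
     + mu / 2 * ((norm U)\<^sup>2 + (norm V)\<^sup>2)"

lemma theta_cond_finite:
  assumes "theta_cond \<theta>" "0 \<le> t"
  shows "\<theta> t = ereal (real_of_ereal (\<theta> t))"
proof (cases "t = 0")
  case True
  then show ?thesis using assms by (simp add: theta_cond_def)
next
  case False
  then have "\<bar>\<theta> t\<bar> \<noteq> \<infinity>" using assms by (simp add: theta_cond_def)
  then show ?thesis by (simp add: ereal_real)
qed

lemma theta_cond_nonneg:
  assumes "theta_cond \<theta>" "0 \<le> t"
  shows "0 \<le> real_of_ereal (\<theta> t)"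
  using assms by (cases "t = 0") (auto simp: theta_cond_def real_of_ereal_pos less_imp_le)

lemma theta_cond_zero: "theta_cond \<theta> \<Longrightarrow> \<theta> 0 = 0"
  by (simp add: theta_cond_def)

lemma theta_cond_deriv:
  assumes "theta_cond \<theta>" "0 < t"
  shows "((\<lambda>s. real_of_ereal (\<theta> s)) has_real_derivative deriv (\<lambda>s. real_of_ereal (\<theta> s)) t) (at t)"
  using assms by (simp add: theta_cond_def DERIV_deriv_iff_real_differentiable)

lemma reg_nonneg: "theta_cond \<theta> \<Longrightarrow> 0 \<le> reg \<theta> W"
  unfolding reg_def by (intro sum_nonneg) (simp add: theta_cond_nonneg)

lemma vartheta_mat_eq:
  assumes "theta_cond \<theta>"
  shows "vartheta_mat \<theta> W = ereal (reg \<theta> W)"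
proof -
  have "\<theta> (norm (column j W)) = ereal (real_of_ereal (\<theta> (norm (column j W))))" for j
    by (rule theta_cond_finite[OF assms]) simp
  then show ?thesis by (simp add: vartheta_def reg_def flip: sum_ereal)
qed

lemma Phi_eq: "theta_cond \<theta> \<Longrightarrow> Phi f \<theta> lam mu U V = ereal (objective f \<theta> lam mu U V)"
  by (simp add: Phi_def vartheta_mat_eq objective_def)

lemma Phi_hat_eq:
  assumes "theta_cond \<theta>"
  shows "Phi_hat f gf L \<theta> lam mu U V U' V' = ereal (
    f (U' ** transpose V') + gf (U' ** transpose V') \<bullet> (U ** transpose V - U' ** transpose V')
    + L / 2 * (norm (U ** transpose V - U' ** transpose V'))\<^sup>2
    + lam * (reg \<theta> U + reg \<theta> V) + mu / 2 * ((norm U)\<^sup>2 + (norm V)\<^sup>2))"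
  using assms by (simp add: Phi_hat_def Let_def vartheta_mat_eq)

lemma mult_transpose_swap: "U ** transpose V = transpose (V ** transpose U)"
  for U :: "('n::finite, 'r::finite) rmat" and V :: "('m::finite, 'r) rmat"
  by (simp add: matrix_transpose_mul)

text \<open>
  Transposition exchanges the two factors. Together with \<open>Phi_hat_swap\<close>, \<open>GDERIV_transpose\<close> and
  \<open>lipschitz_transpose\<close> it turns a \<open>V\<close>-step into a \<open>U\<close>-step for \<open>X \<mapsto> f(X\<^sup>T)\<close>, so that one half step
  has to be analysed only once.
\<close>

lemma objective_swap:
  "objective f \<theta> lam mu U V = objective (\<lambda>X. f (transpose X)) \<theta> lam mu V U"
  unfolding objective_def by (simp add: matrix_transpose_mul add.commute)

lemma Phi_hat_swap:
  assumes "theta_cond \<theta>"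
  shows "Phi_hat f gf L \<theta> lam mu U V U' V'
    = Phi_hat (\<lambda>X. f (transpose X)) (\<lambda>X. transpose (gf (transpose X))) L \<theta> lam mu V U V' U'"
proof -
  have diff: "V ** transpose U - V' ** transpose U' = transpose (U ** transpose V - U' ** transpose V')"
    by (simp add: matrix_transpose_mul transpose_def vec_eq_iff matrix_matrix_mult_def mult.commute)
  show ?thesis
    unfolding Phi_hat_eq[OF assms] diff inner_transpose norm_transpose
    by (simp add: matrix_transpose_mul add.commute)
qed


section \<open>Linearity and continuity of matrix operations\<close>

lemma bounded_linear_column: "bounded_linear (\<lambda>W :: ('a::finite, 'b::finite) rmat. column j W)"
  unfolding linear_conv_bounded_linear[symmetric]
  by (intro linearI) (auto simp: column_def vec_eq_iff)

lemma bounded_linear_transpose: "bounded_linear (transpose :: ('a::finite, 'b::finite) rmat \<Rightarrow> _)"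
  unfolding linear_conv_bounded_linear[symmetric]
  by (intro linearI) (auto simp: transpose_def vec_eq_iff)

lemma bounded_bilinear_mult_transpose:
  "bounded_bilinear (\<lambda>(U :: ('a::finite, 'c::finite) rmat) (V :: ('b::finite, 'c) rmat). U ** transpose V)"
  unfolding bilinear_conv_bounded_bilinear[symmetric] bilinear_def
  by (auto intro!: linearI simp: matrix_matrix_mult_def transpose_def vec_eq_iff
      algebra_simps sum.distrib sum_distrib_left)

lemmas tendsto_column = bounded_linear.tendsto[OF bounded_linear_column]
lemmas tendsto_mult_transpose = bounded_bilinear.tendsto[OF bounded_bilinear_mult_transpose]

lemma GDERIV_transpose:
  fixes f :: "('a::finite, 'b::finite) rmat \<Rightarrow> real"
  assumes "GDERIV f (transpose X) :> G"
  shows "GDERIV (\<lambda>X. f (transpose X)) X :> transpose G"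
proof -
  have D: "(f has_derivative (\<lambda>h. h \<bullet> G)) (at (transpose X))"
    using assms by (simp add: gderiv_def)
  have "((\<lambda>X. f (transpose X)) has_derivative (\<lambda>h. transpose h \<bullet> G)) (at X)"
    by (rule has_derivative_compose[OF bounded_linear_imp_has_derivative[OF bounded_linear_transpose] D])
  moreover have "transpose h \<bullet> G = h \<bullet> transpose G" for h :: "('b, 'a) rmat"
    by (metis inner_transpose transpose_transpose)
  ultimately show ?thesis by (simp add: gderiv_def)
qed

lemma dist_transpose: "dist (transpose A) (transpose B) = dist A B"
  for A B :: "('a::finite, 'b::finite) rmat"
proof -
  have "transpose A - transpose B = transpose (A - B)"
    by (simp add: transpose_def vec_eq_iff)
  then show ?thesis by (simp add: dist_norm norm_transpose)
qed

lemma lipschitz_transpose: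
  fixes g :: "('a::finite, 'b::finite) rmat \<Rightarrow> ('a, 'b) rmat"
  assumes "L-lipschitz_on UNIV g"
  shows "L-lipschitz_on UNIV (\<lambda>X. transpose (g (transpose X)))"
  using assms by (simp add: lipschitz_on_def dist_transpose) (metis dist_transpose)


section \<open>Descent and limits of one proximal step\<close>

text \<open>
  Along the segment from \<open>X\<close> to \<open>Y\<close>, the difference between the two sides is monotone because the
  Lipschitz condition bounds the change of the directional derivative by \<open>L t \<parallel>Y - X\<parallel>\<^sup>2\<close>.
\<close>

lemma lipschitz_gradient_upper_bound:
  fixes f :: "'a::real_inner \<Rightarrow> real"
  assumes f: "\<And>X. GDERIV f X :> gf X" and lip: "L-lipschitz_on UNIV gf"
  shows "f Y \<le> f X + gf X \<bullet> (Y - X) + L / 2 * (norm (Y - X))\<^sup>2"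
proof -
  let ?D = "Y - X"
  define p where "p t = f (X + t *\<^sub>R ?D) - t * (gf X \<bullet> ?D) - L / 2 * t\<^sup>2 * (norm ?D)\<^sup>2" for t
  have "p 1 \<le> p 0"
  proof (rule DERIV_nonpos_imp_nonincreasing[of 0 1 p])
    fix t :: real assume t: "0 \<le> t" "t \<le> 1"
    let ?Z = "X + t *\<^sub>R ?D"
    have "((\<lambda>t. X + t *\<^sub>R ?D) has_derivative (\<lambda>s. s *\<^sub>R ?D)) (at t)"
      by (auto intro!: derivative_eq_intros)
    moreover have "(f has_derivative (\<lambda>h. h \<bullet> gf ?Z)) (at ?Z)"
      using f by (simp add: gderiv_def)
    ultimately have "((\<lambda>t. f (X + t *\<^sub>R ?D)) has_derivative (\<lambda>s. (s *\<^sub>R ?D) \<bullet> gf ?Z)) (at t)"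
      by (rule has_derivative_compose)
    then have "((\<lambda>t. f (X + t *\<^sub>R ?D)) has_real_derivative (?D \<bullet> gf ?Z)) (at t)"
      by (simp add: has_field_derivative_def mult.commute[of _ "?D \<bullet> gf ?Z"])
    then have "(p has_real_derivative (?D \<bullet> gf ?Z - gf X \<bullet> ?D - L * t * (norm ?D)\<^sup>2)) (at t)"
      unfolding p_def by (auto intro!: derivative_eq_intros)
    moreover have "?D \<bullet> gf ?Z - gf X \<bullet> ?D \<le> L * t * (norm ?D)\<^sup>2"
    proof -
      have "?D \<bullet> gf ?Z - gf X \<bullet> ?D = ?D \<bullet> (gf ?Z - gf X)"
        by (simp add: inner_diff_right inner_commute)
      also have "\<dots> \<le> norm ?D * norm (gf ?Z - gf X)" by (rule norm_cauchy_schwarz)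
      also have "\<dots> \<le> norm ?D * (L * norm (?Z - X))"
        using lipschitz_onD[OF lip, of ?Z X] by (simp add: dist_norm mult_left_mono)
      also have "\<dots> = L * t * (norm ?D)\<^sup>2" using t by (simp add: power2_eq_square)
      finally show ?thesis .
    qed
    ultimately show "\<exists>y. (p has_real_derivative y) (at t) \<and> y \<le> 0" by fastforce
  qed simp
  then show ?thesis by (simp add: p_def)
qed

text \<open>
  The function minimized in a half step, up to terms that do not depend on \<open>W\<close>.
\<close>

definition proximal_model ::
  "(('n::finite, 'm::finite) rmat \<Rightarrow> ('n, 'm) rmat) \<Rightarrow> real \<Rightarrow> (real \<Rightarrow> ereal) \<Rightarrow> real \<Rightarrow> real \<Rightarrow>
   real \<Rightarrow> ('n, 'r::finite) rmat \<Rightarrow> ('m, 'r) rmat \<Rightarrow> ('n, 'r) rmat \<Rightarrow> real"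
where
  "proximal_model gf L \<theta> lam mu g A B W =
     gf (A ** transpose B) \<bullet> (W ** transpose B - A ** transpose B)
     + L / 2 * (norm (W ** transpose B - A ** transpose B))\<^sup>2
     + lam * reg \<theta> W + mu / 2 * (norm W)\<^sup>2 + g / 2 * (norm (W - A))\<^sup>2"

lemma argmin_proximal_model:
  assumes "theta_cond \<theta>"
    and "is_arg_min (\<lambda>W. Phi_hat f gf L \<theta> lam mu W B A B + ereal (g / 2 * (norm (W - A))\<^sup>2))
          (\<lambda>_. True) A'"
  shows "proximal_model gf L \<theta> lam mu g A B A' \<le> proximal_model gf L \<theta> lam mu g A B W"
proof -
  have "Phi_hat f gf L \<theta> lam mu A' B A B + ereal (g / 2 * (norm (A' - A))\<^sup>2)
      \<le> Phi_hat f gf L \<theta> lam mu W B A B + ereal (g / 2 * (norm (W - A))\<^sup>2)"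
    using assms(2) by (simp add: is_arg_min_linorder)
  then show ?thesis
    by (simp add: Phi_hat_eq[OF assms(1)] proximal_model_def distrib_left)
qed

lemma proximal_step_descent:
  assumes f: "\<And>X. GDERIV f X :> gf X" and lip: "L-lipschitz_on UNIV gf"
    and min: "proximal_model gf L \<theta> lam mu g A B A' \<le> proximal_model gf L \<theta> lam mu g A B A"
  shows "objective f \<theta> lam mu A' B + g / 2 * (norm (A' - A))\<^sup>2 \<le> objective f \<theta> lam mu A B"
  using min lipschitz_gradient_upper_bound[OF f lip, of "A' ** transpose B" "A ** transpose B"]
  by (simp add: proximal_model_def objective_def algebra_simps)

lemma tendsto_theta_column:
  fixes W :: "'k \<Rightarrow> ('l::finite, 'r::finite) rmat"
  assumes th: "theta_cond \<theta>" and W: "(W \<longlongrightarrow> W') F" and nz: "column j W' \<noteq> 0"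
  shows "((\<lambda>k. real_of_ereal (\<theta> (norm (column j (W k))))) \<longlongrightarrow>
    real_of_ereal (\<theta> (norm (column j W')))) F"
proof -
  have "isCont (\<lambda>s. real_of_ereal (\<theta> s)) (norm (column j W'))"
    by (rule DERIV_isCont[OF theta_cond_deriv[OF th]]) (use nz in simp)
  then show ?thesis
    by (rule isCont_tendsto_compose) (intro tendsto_norm tendsto_column W)
qed

text \<open>
  Lower semicontinuity of \<open>reg\<close> is made explicit: the sum \<open>S\<close> over the columns that are nonzero in the
  limit converges, and the remaining columns contribute nonnegative amounts. The minimality of
  \<open>Ap k\<close>, tested at an arbitrary \<open>W\<close>, then passes to the limit with \<open>C\<close> in place of the varying
  weights; tested at \<open>W = A'\<close>, it bounds \<open>reg \<theta> (Ap k)\<close> from above by a sequence that tends to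
  \<open>reg \<theta> A'\<close>.
\<close>

lemma proximal_step_limit:
  fixes A Ap :: "nat \<Rightarrow> ('n::finite, 'r::finite) rmat" and B :: "nat \<Rightarrow> ('m::finite, 'r) rmat"
  assumes th: "theta_cond \<theta>" and lam: "0 < lam" and L: "0 \<le> L"
    and cont: "continuous_on UNIV gf"
    and A: "A \<longlonglongrightarrow> A'" and B: "B \<longlonglongrightarrow> B'" and Ap: "(\<lambda>k. Ap k - A k) \<longlonglongrightarrow> 0"
    and g: "\<And>k. 0 \<le> g k" "\<And>k. g k \<le> C"
    and min: "\<And>k W. proximal_model gf L \<theta> lam mu (g k) (A k) (B k) (Ap k)
                  \<le> proximal_model gf L \<theta> lam mu (g k) (A k) (B k) W"
  shows "(\<lambda>k. reg \<theta> (Ap k)) \<longlonglongrightarrow> reg \<theta> A'"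
    and "proximal_model gf L \<theta> lam mu C A' B' A' \<le> proximal_model gf L \<theta> lam mu C A' B' W"
proof -
  let ?J = "{j. column j A' \<noteq> 0}"
  let ?X = "\<lambda>k. A k ** transpose (B k)" and ?X' = "A' ** transpose B'"
  \<comment> \<open>\<open>S\<close> and \<open>lower\<close> collect the terms of the model whose limits are known without
    control of \<open>reg\<close>.\<close>
  define S where "S k = (\<Sum>j\<in>?J. real_of_ereal (\<theta> (norm (column j (Ap k)))))" for k
  define lower where "lower k = gf (?X k) \<bullet> (Ap k ** transpose (B k) - ?X k) + mu / 2 * (norm (Ap k))\<^sup>2" for k
  have Ap': "Ap \<longlonglongrightarrow> A'" using tendsto_add[OF A Ap] by simp
  have X: "?X \<longlonglongrightarrow> ?X'" by (intro tendsto_mult_transpose A B)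
  have G: "(\<lambda>k. gf (?X k)) \<longlonglongrightarrow> gf ?X'"
    by (rule isCont_tendsto_compose[OF _ X]) (use cont in \<open>simp add: continuous_on_eq_continuous_at\<close>)
  have "S \<longlonglongrightarrow> (\<Sum>j\<in>?J. real_of_ereal (\<theta> (norm (column j A'))))"
    unfolding S_def by (intro tendsto_sum tendsto_theta_column[OF th Ap']) simp
  also have "(\<Sum>j\<in>?J. real_of_ereal (\<theta> (norm (column j A')))) = reg \<theta> A'"
    unfolding reg_def by (rule sum.mono_neutral_left) (auto simp: theta_cond_zero[OF th])
  finally have S: "S \<longlonglongrightarrow> reg \<theta> A'" .
  have S_le: "S k \<le> reg \<theta> (Ap k)" for k
    unfolding S_def reg_def by (intro sum_mono2) (auto simp: theta_cond_nonneg[OF th])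
  have "lower \<longlonglongrightarrow> gf ?X' \<bullet> (?X' - ?X') + mu / 2 * (norm A')\<^sup>2"
    unfolding lower_def by (intro tendsto_intros G X tendsto_mult_transpose Ap' B)
  then have lower: "lower \<longlonglongrightarrow> mu / 2 * (norm A')\<^sup>2" by simp
  have le: "lower k + lam * reg \<theta> (Ap k) \<le> proximal_model gf L \<theta> lam mu C (A k) (B k) W" for k W
  proof -
    have "lower k + lam * reg \<theta> (Ap k) \<le> proximal_model gf L \<theta> lam mu (g k) (A k) (B k) (Ap k)"
      using g(1)[of k] L by (simp add: lower_def proximal_model_def)
    also have "\<dots> \<le> proximal_model gf L \<theta> lam mu (g k) (A k) (B k) W" by (rule min)
    also have "\<dots> \<le> proximal_model gf L \<theta> lam mu C (A k) (B k) W"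
      using g(2)[of k] by (simp add: proximal_model_def mult_right_mono)
    finally show ?thesis .
  qed
  have model: "(\<lambda>k. proximal_model gf L \<theta> lam mu C (A k) (B k) W)
      \<longlonglongrightarrow> proximal_model gf L \<theta> lam mu C A' B' W" for W
    unfolding proximal_model_def by (intro tendsto_intros G X tendsto_mult_transpose A B)
  have model_self: "proximal_model gf L \<theta> lam mu C A' B' A' = mu / 2 * (norm A')\<^sup>2 + lam * reg \<theta> A'"
    by (simp add: proximal_model_def)
  show "proximal_model gf L \<theta> lam mu C A' B' A' \<le> proximal_model gf L \<theta> lam mu C A' B' W"
  proof (rule LIMSEQ_le)
    show "(\<lambda>k. lower k + lam * S k) \<longlonglongrightarrow> proximal_model gf L \<theta> lam mu C A' B' A'"
      unfolding model_self by (intro tendsto_intros lower S)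
    show "\<exists>N. \<forall>k\<ge>N. lower k + lam * S k \<le> proximal_model gf L \<theta> lam mu C (A k) (B k) W"
      using le S_le lam by (smt (verit) mult_left_mono)
  qed (rule model)
  show "(\<lambda>k. reg \<theta> (Ap k)) \<longlonglongrightarrow> reg \<theta> A'"
  proof (rule tendsto_sandwich[OF _ _ S])
    show "(\<lambda>k. (proximal_model gf L \<theta> lam mu C (A k) (B k) A' - lower k) / lam) \<longlonglongrightarrow> reg \<theta> A'"
      using tendsto_divide[OF tendsto_diff[OF model[of A'] lower] tendsto_const[of lam]] lam
      by (simp add: model_self)
    show "\<forall>\<^sub>F k in sequentially. reg \<theta> (Ap k)
        \<le> (proximal_model gf L \<theta> lam mu C (A k) (B k) A' - lower k) / lam"
      using le[of _ A'] lam by (intro always_eventually allI) (simp add: field_simps)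
  qed (simp add: S_le)
qed

text \<open>
  The factor by which a nonzero column of norm \<open>t\<close> is multiplied in the gradient of the two
  regularizing terms.
\<close>

definition column_weight :: "(real \<Rightarrow> ereal) \<Rightarrow> real \<Rightarrow> real \<Rightarrow> real \<Rightarrow> real" where
  "column_weight \<theta> lam mu t = mu + lam * (deriv (\<lambda>s. real_of_ereal (\<theta> s)) t / t)"

lemma has_derivative_theta_norm:
  fixes x :: "'a::real_inner"
  assumes "theta_cond \<theta>" "x \<noteq> 0"
  shows "((\<lambda>y. real_of_ereal (\<theta> (norm y))) has_derivative
    (\<lambda>h. deriv (\<lambda>s. real_of_ereal (\<theta> s)) (norm x) / norm x * (x \<bullet> h))) (at x)"
proof -
  have "((\<lambda>y. real_of_ereal (\<theta> (norm y))) has_derivative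
    (\<lambda>h. deriv (\<lambda>s. real_of_ereal (\<theta> s)) (norm x) * (h \<bullet> sgn x))) (at x)"
    using has_derivative_compose[OF has_derivative_norm[OF assms(2)]
        theta_cond_deriv[OF assms(1), of "norm x", unfolded has_field_derivative_def]] assms(2)
    by simp
  then show ?thesis by (simp add: sgn_div_norm inner_commute field_simps)
qed

text \<open>
  Fermat's rule: the model is differentiable in the directions that perturb only a nonzero column,
  and its quadratic terms in \<open>W - A\<close> have zero derivative at \<open>A\<close>.
\<close>

lemma proximal_model_minimizer_column:
  fixes A :: "('n::finite, 'r::finite) rmat" and B :: "('m::finite, 'r) rmat"
  assumes th: "theta_cond \<theta>"
    and min: "\<And>W. proximal_model gf L \<theta> lam mu C A B A \<le> proximal_model gf L \<theta> lam mu C A B W"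
    and nz: "column j A \<noteq> 0"
  shows "gf (A ** transpose B) *v column j B
    + column_weight \<theta> lam mu (norm (column j A)) *\<^sub>R column j A = 0"
proof -
  let ?G = "gf (A ** transpose B)" and ?a = "column j A"
  let ?th = "\<lambda>s. real_of_ereal (\<theta> s)"
  let ?s = "?G *v column j B + column_weight \<theta> lam mu (norm ?a) *\<^sub>R ?a"
  have "?s \<bullet> e = 0" for e
  proof -
    define E :: "('n, 'r) rmat" where "E = (\<chi> a i. if i = j then e $ a else 0)"
    have colE: "column i E = (if i = j then e else 0)" for i
      by (simp add: E_def column_def vec_eq_iff)
    have innerE: "M \<bullet> E = column j M \<bullet> e" for M :: "('n, 'r) rmat"
      by (simp add: inner_columns colE if_distrib cong: if_cong)
    define c where "c = (\<Sum>i\<in>UNIV - {j}. ?th (norm (column i A)))"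
    have reg: "reg \<theta> (A + t *\<^sub>R E) = ?th (norm (?a + t *\<^sub>R e)) + c" for t
    proof -
      have col: "column i (A + t *\<^sub>R E) = column i A + t *\<^sub>R column i E" for i
        by (simp add: column_def vec_eq_iff)
      show ?thesis
        unfolding reg_def c_def by (subst sum.remove[of UNIV j]) (auto simp: col colE)
    qed
    have lin: "(A + t *\<^sub>R E) ** transpose B - A ** transpose B = t *\<^sub>R (E ** transpose B)" for t
      by (simp add: bounded_bilinear.add_left[OF bounded_bilinear_mult_transpose]
          bounded_bilinear.scaleR_left[OF bounded_bilinear_mult_transpose])
    define p where "p t = proximal_model gf L \<theta> lam mu C A B (A + t *\<^sub>R E)" for t
    have p: "p t = t * (?G \<bullet> (E ** transpose B)) + L / 2 * t\<^sup>2 * (norm (E ** transpose B))\<^sup>2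
        + lam * (?th (norm (?a + t *\<^sub>R e)) + c)
        + mu / 2 * ((norm A)\<^sup>2 + 2 * t * (A \<bullet> E) + t\<^sup>2 * (norm E)\<^sup>2) + C / 2 * t\<^sup>2 * (norm E)\<^sup>2" for t
    proof -
      have "(norm (A + t *\<^sub>R E))\<^sup>2 = (norm A)\<^sup>2 + 2 * t * (A \<bullet> E) + t\<^sup>2 * (norm E)\<^sup>2"
        unfolding power2_norm_eq_inner
        by (simp add: inner_add_left inner_add_right inner_commute[of E A] power2_eq_square
            algebra_simps)
      then show ?thesis
        by (simp add: p_def proximal_model_def reg lin power_mult_distrib)
    qed
    have "((\<lambda>t. ?a + t *\<^sub>R e) has_derivative (\<lambda>t. t *\<^sub>R e)) (at 0)"
      by (auto intro!: derivative_eq_intros)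
    moreover have "((\<lambda>y. ?th (norm y)) has_derivative (\<lambda>h. deriv ?th (norm ?a) / norm ?a * (?a \<bullet> h)))
        (at (?a + 0 *\<^sub>R e))"
      using has_derivative_theta_norm[OF th nz] by simp
    ultimately have "((\<lambda>t. ?th (norm (?a + t *\<^sub>R e))) has_derivative
        (\<lambda>t. deriv ?th (norm ?a) / norm ?a * (?a \<bullet> (t *\<^sub>R e)))) (at 0)"
      by (rule has_derivative_compose)
    then have dth: "((\<lambda>t. ?th (norm (?a + t *\<^sub>R e))) has_real_derivative
        deriv ?th (norm ?a) / norm ?a * (?a \<bullet> e)) (at 0)"
      unfolding has_field_derivative_def by (rule has_derivative_eq_rhs) (auto simp: mult_ac)
    have quad: "((\<lambda>t. c1 * t + K * t\<^sup>2 + lam * h t + c0) has_real_derivative (c1 + lam * h')) (at 0)"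
      if "(h has_real_derivative h') (at 0)" for h h' and c1 K c0 :: real
      using that by (auto intro!: derivative_eq_intros)
    define c1 where "c1 = ?G \<bullet> (E ** transpose B) + mu * (A \<bullet> E)"
    define K where "K = L / 2 * (norm (E ** transpose B))\<^sup>2 + (mu + C) / 2 * (norm E)\<^sup>2"
    define c0 where "c0 = lam * c + mu / 2 * (norm A)\<^sup>2"
    have "p = (\<lambda>t. c1 * t + K * t\<^sup>2 + lam * ?th (norm (?a + t *\<^sub>R e)) + c0)"
      unfolding p c1_def K_def c0_def by (rule ext) (simp add: field_simps)
    then have dp: "(p has_real_derivative (c1 + lam * (deriv ?th (norm ?a) / norm ?a * (?a \<bullet> e)))) (at 0)"
      by (simp only: quad[OF dth])
    have "p 0 \<le> p t" for t
      unfolding p_def using min by simp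
    then have "c1 + lam * (deriv ?th (norm ?a) / norm ?a * (?a \<bullet> e)) = 0"
      by (intro DERIV_local_min[OF dp, of 1]) auto
    moreover have "?G \<bullet> (E ** transpose B) = (?G *v column j B) \<bullet> e"
      by (simp only: inner_mult_transpose innerE column_mult)
    ultimately show ?thesis
      by (simp add: c1_def innerE column_weight_def inner_add_left algebra_simps)
  qed
  then show ?thesis by (metis inner_eq_zero_iff)
qed


section \<open>Limits and comparison of balanced factorizations\<close>

lemma compact_orthonormal_cols: "compact {P :: ('l::finite, 'r::finite) rmat. orthonormal_cols P}"
  unfolding compact_eq_bounded_closed
proof
  have "norm P \<le> sqrt (CARD('r))" if "orthonormal_cols P" for P :: "('l, 'r) rmat"
  proof -
    have "(norm (column j P))\<^sup>2 = 1" for j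
      using that by (simp add: orthonormal_cols_iff power2_norm_eq_inner)
    then have "(norm P)\<^sup>2 = CARD('r)" by (simp add: norm_sq_columns)
    then show ?thesis by (metis norm_ge_zero real_sqrt_unique order_refl)
  qed
  then show "bounded {P :: ('l, 'r) rmat. orthonormal_cols P}"
    unfolding bounded_iff by blast
  have cont: "continuous_on UNIV (\<lambda>P :: ('l, 'r) rmat. column i P \<bullet> column j P)" for i j
    by (intro continuous_intros linear_continuous_on bounded_linear_column)
  have "closed {P :: ('l, 'r) rmat. \<forall>i j. column i P \<bullet> column j P = (if i = j then 1 else 0)}"
    by (intro closed_Collect_all closed_Collect_eq cont continuous_on_const)
  then show "closed {P :: ('l, 'r) rmat. orthonormal_cols P}"
    by (simp add: orthonormal_cols_iff)
qed

text \<open>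
  The matrices with orthonormal columns are compact, so \<open>P\<close> and \<open>Q\<close> converge along a subsequence,
  while \<open>d\<close> converges as the vector of column norms.
\<close>

lemma balanced_svd_limit:
  assumes bal: "\<And>k. balanced_svd (U k) (V k) (P k) (Q k) (d k)"
    and U: "U \<longlonglongrightarrow> U'" and V: "V \<longlonglongrightarrow> V'"
  obtains P' Q' d' where "balanced_svd U' V' P' Q' d'"
proof -
  have compact: "seq_compact ({P. orthonormal_cols P} \<times> {Q. orthonormal_cols Q})"
    by (intro compact_imp_seq_compact compact_Times compact_orthonormal_cols)
  have "\<forall>k. (P k, Q k) \<in> {P. orthonormal_cols P} \<times> {Q. orthonormal_cols Q}"
    using bal by (simp add: balanced_svd_def)
  from seq_compactE[OF compact this]
  obtain PQ s where PQ: "PQ \<in> {P. orthonormal_cols P} \<times> {Q. orthonormal_cols Q}"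
    and s: "strict_mono s" and lim: "((\<lambda>k. (P k, Q k)) \<circ> s) \<longlonglongrightarrow> PQ"
    by blast
  have P: "(\<lambda>k. P (s k)) \<longlonglongrightarrow> fst PQ" using tendsto_fst[OF lim] by (simp add: o_def)
  have Q: "(\<lambda>k. Q (s k)) \<longlonglongrightarrow> snd PQ" using tendsto_snd[OF lim] by (simp add: o_def)
  have U: "(\<lambda>k. U (s k)) \<longlonglongrightarrow> U'" using LIMSEQ_subseq_LIMSEQ[OF U s] by (simp add: o_def)
  have V: "(\<lambda>k. V (s k)) \<longlonglongrightarrow> V'" using LIMSEQ_subseq_LIMSEQ[OF V s] by (simp add: o_def)
  have d: "(\<lambda>k. d (s k) j) \<longlonglongrightarrow> norm (column j U')" for j
    using tendsto_norm[OF tendsto_column[OF U, of j]] balanced_svd_column_norms(1)[OF bal] by simp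
  have "norm (column j U') \<le> norm (column i U')" if "i \<le> j" for i j
    by (rule LIMSEQ_le[OF d d]) (use bal that in \<open>auto simp: balanced_svd_def\<close>)
  moreover have "column j U' = norm (column j U') *\<^sub>R column j (fst PQ)" for j
  proof (rule LIMSEQ_unique[OF tendsto_column[OF U]])
    show "(\<lambda>k. column j (U (s k))) \<longlonglongrightarrow> norm (column j U') *\<^sub>R column j (fst PQ)"
      using tendsto_scaleR[OF d tendsto_column[OF P], of j j] bal by (simp add: balanced_svd_def)
  qed
  moreover have "column j V' = norm (column j U') *\<^sub>R column j (snd PQ)" for j
  proof (rule LIMSEQ_unique[OF tendsto_column[OF V]])
    show "(\<lambda>k. column j (V (s k))) \<longlonglongrightarrow> norm (column j U') *\<^sub>R column j (snd PQ)"
      using tendsto_scaleR[OF d tendsto_column[OF Q], of j j] bal by (simp add: balanced_svd_def)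
  qed
  ultimately have "balanced_svd U' V' (fst PQ) (snd PQ) (\<lambda>j. norm (column j U'))"
    using PQ by (auto simp: balanced_svd_def)
  then show ?thesis by (rule that)
qed

text \<open>
  Both vectors consist of the square roots of the leading singular values of the common product.
\<close>

lemma balanced_svd_unique_values:
  fixes U U' :: "('n::{finite,linorder}, 'r::{finite,linorder}) rmat"
    and V V' :: "('m::{finite,linorder}, 'r) rmat"
  assumes dims: "CARD('r) \<le> CARD('n)" "CARD('n) \<le> CARD('m)"
    and bal: "balanced_svd U V P Q d" and bal': "balanced_svd U' V' P' Q' d'"
    and eq: "U ** transpose V = U' ** transpose V'"
  shows "d = d'"
proof
  fix j
  have "(d j)\<^sup>2 = (d' j)\<^sup>2"
    using balanced_svd_extend[OF dims bal] balanced_svd_extend[OF dims bal'] eq by metis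
  then show "d j = d' j"
    using bal bal' by (simp add: balanced_svd_def)
qed

lemma orthonormal_cols_coefficient:
  assumes "orthonormal_cols M"
  shows "column i M \<bullet> (\<Sum>k\<in>UNIV. g k *\<^sub>R column k M) = g i"
proof -
  have "column i M \<bullet> column k M = (if i = k then 1 else 0)" for k
    using assms by (simp add: orthonormal_cols_iff)
  then have "column i M \<bullet> (\<Sum>k\<in>UNIV. g k *\<^sub>R column k M) = (\<Sum>k\<in>UNIV. if i = k then g k else 0)"
    unfolding inner_sum_right inner_scaleR_right by (intro sum.cong) auto
  then show ?thesis by simp
qed

text \<open>
  Let \<open>a\<^sub>i\<close> and \<open>b\<^sub>i\<close> be the coefficients of \<open>P\<^sub>j\<close> and \<open>Q\<^sub>j\<close> with respect to the other pair of singular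
  vectors. Applying \<open>X\<close> and \<open>X\<^sup>T\<close> shows \<open>d\<^sub>j\<^sup>2 a\<^sub>i = d\<^sub>i\<^sup>2 b\<^sub>i\<close> and \<open>d\<^sub>j\<^sup>2 b\<^sub>i = d\<^sub>i\<^sup>2 a\<^sub>i\<close>. As
  \<open>d\<^sub>j \<noteq> 0\<close>, both vanish unless
  \<open>d\<^sub>i = d\<^sub>j\<close>, and then they agree; an equation whose factor depends on \<open>d\<^sub>i\<close> only is therefore
  inherited by the linear combination.
\<close>

lemma balanced_svd_transfer:
  fixes H :: "('m::{finite,linorder}, 'n::{finite,linorder}) rmat"
  assumes bal: "balanced_svd U V P Q d" and bal': "balanced_svd U' V' P' Q' d"
    and eq: "U ** transpose V = U' ** transpose V'"
    and H: "\<And>i. d i \<noteq> 0 \<Longrightarrow> H *v column i P' = c (d i) *\<^sub>R column i Q'"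
    and nz: "d j \<noteq> 0"
  shows "H *v column j P = c (d j) *\<^sub>R column j Q"
proof -
  define a b where "a i = column i P' \<bullet> column j P" and "b i = column i Q' \<bullet> column j Q" for i
  have expP: "(d j)\<^sup>2 *\<^sub>R column j P = (\<Sum>i\<in>UNIV. ((d i)\<^sup>2 * b i) *\<^sub>R column i P')"
    using balanced_svd_singular_vector[OF bal, of j] bal'
    by (simp add: eq mult_transpose_vec balanced_svd_def b_def power2_eq_square mult_ac)
  have eq': "V ** transpose U = V' ** transpose U'"
    using eq by (metis matrix_transpose_mul transpose_transpose)
  have expQ: "(d j)\<^sup>2 *\<^sub>R column j Q = (\<Sum>i\<in>UNIV. ((d i)\<^sup>2 * a i) *\<^sub>R column i Q')"
    using balanced_svd_singular_vector[OF balanced_svd_swap[OF bal], of j] bal'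
    by (simp add: eq' mult_transpose_vec balanced_svd_def a_def power2_eq_square mult_ac)
  have ab: "(d j)\<^sup>2 * a i = (d i)\<^sup>2 * b i" for i
    using arg_cong[OF expP, of "\<lambda>x. column i P' \<bullet> x"] bal'
    by (simp add: orthonormal_cols_coefficient balanced_svd_def a_def)
  have ba: "(d j)\<^sup>2 * b i = (d i)\<^sup>2 * a i" for i
    using arg_cong[OF expQ, of "\<lambda>x. column i Q' \<bullet> x"] bal'
    by (simp add: orthonormal_cols_coefficient balanced_svd_def b_def)
  \<comment> \<open>Both sides vanish if \<open>d i \<noteq> d j\<close>, since the coefficients are then zero.\<close>
  have summand: "(d i)\<^sup>2 * b i * c (d i) = (d i)\<^sup>2 * a i * c (d j)" for i
  proof (cases "d i = d j")
    case True
    then show ?thesis using ab[of i] nz by simp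
  next
    case False
    have "((d j)\<^sup>2 - (d i)\<^sup>2) * (a i + b i) = 0" "((d j)\<^sup>2 + (d i)\<^sup>2) * (a i - b i) = 0"
      using ab[of i] ba[of i] by (simp_all add: algebra_simps)
    moreover have "(d j)\<^sup>2 \<noteq> (d i)\<^sup>2"
      using False bal by (simp add: balanced_svd_def power2_eq_iff_nonneg)
    moreover have "(d j)\<^sup>2 + (d i)\<^sup>2 \<noteq> 0" using nz by (simp add: sum_power2_eq_zero_iff)
    ultimately have "a i = 0" "b i = 0" by auto
    then show ?thesis by simp
  qed
  have "(d j)\<^sup>2 *\<^sub>R (H *v column j P) = H *v ((d j)\<^sup>2 *\<^sub>R column j P)"
    by (simp add: matrix_vector_mult_scaleR)
  also have "\<dots> = (\<Sum>i\<in>UNIV. ((d i)\<^sup>2 * b i) *\<^sub>R (H *v column i P'))"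
    unfolding expP by (simp add: linear_sum[OF matrix_vector_mul_linear] matrix_vector_mult_scaleR)
  also have "\<dots> = (\<Sum>i\<in>UNIV. ((d i)\<^sup>2 * a i * c (d j)) *\<^sub>R column i Q')"
  proof (rule sum.cong[OF refl])
    fix i
    show "((d i)\<^sup>2 * b i) *\<^sub>R (H *v column i P') = ((d i)\<^sup>2 * a i * c (d j)) *\<^sub>R column i Q'"
      using H[of i] summand[of i] by (cases "d i = 0") auto
  qed
  also have "\<dots> = c (d j) *\<^sub>R ((d j)\<^sup>2 *\<^sub>R column j Q)"
    unfolding expQ by (simp add: scaleR_sum_right mult_ac)
  finally have "(d j)\<^sup>2 *\<^sub>R (H *v column j P) = (d j)\<^sup>2 *\<^sub>R (c (d j) *\<^sub>R column j Q)"
    by (simp add: mult.commute)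
  then show ?thesis using nz by (simp only: scaleR_cancel_left) simp
qed


section \<open>From column equations to stationary points\<close>

text \<open>
  The difference quotient in the definition of the subdifferential, freed of extended reals and
  division.
\<close>

lemma frechet_subdiffI:
  fixes g :: "'a::euclidean_space \<Rightarrow> real"
  assumes "\<And>e. 0 < e \<Longrightarrow> \<forall>\<^sub>F y in at x. g y - g x - v \<bullet> (y - x) \<ge> - e * norm (y - x)"
  shows "v \<in> frechet_subdiff (\<lambda>y. ereal (g y)) x"
proof -
  have "0 \<le> Liminf (at x) (\<lambda>y. (ereal (g y) - ereal (g x) - ereal (v \<bullet> (y - x))) / ereal (norm (y - x)))"
    unfolding le_Liminf_iff
  proof (intro allI impI)
    fix z :: ereal assume "z < 0"
    then obtain e :: real where e: "z < ereal e" "ereal e < 0" using ereal_dense2 by blast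
    then have "e < 0" by simp
    then have "\<forall>\<^sub>F y in at x. g y - g x - v \<bullet> (y - x) \<ge> e * norm (y - x)"
      using assms[of "- e"] by simp
    moreover have "\<forall>\<^sub>F y in at x. y \<noteq> x" by (simp add: eventually_at_filter)
    ultimately show "\<forall>\<^sub>F y in at x. z < (ereal (g y) - ereal (g x) - ereal (v \<bullet> (y - x))) / ereal (norm (y - x))"
    proof eventually_elim
      case (elim y)
      then have "e \<le> (g y - g x - v \<bullet> (y - x)) / norm (y - x)" by (simp add: field_simps)
      then have "ereal e \<le> (ereal (g y) - ereal (g x) - ereal (v \<bullet> (y - x))) / ereal (norm (y - x))"
        using elim by simp
      with e(1) show ?case by (rule less_le_trans)
    qed
  qed
  then show ?thesis by (simp add: frechet_subdiff_def)
qed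

text \<open>
  Constant sequences witness the limits.
\<close>

lemma frechet_subset_limiting_subdiff: "frechet_subdiff h x \<subseteq> limiting_subdiff h x"
proof
  fix v assume v: "v \<in> frechet_subdiff h x"
  have "\<exists>xs vs. xs \<longlonglongrightarrow> x \<and> (\<lambda>k. h (xs k)) \<longlonglongrightarrow> h x \<and>
      (\<forall>k. vs k \<in> frechet_subdiff h (xs k)) \<and> vs \<longlonglongrightarrow> v"
    by (rule exI[of _ "\<lambda>_. x"], rule exI[of _ "\<lambda>_. v"]) (simp add: v)
  moreover have "\<bar>h x\<bar> \<noteq> \<infinity>" using v by (simp add: frechet_subdiff_def)
  ultimately show "v \<in> limiting_subdiff h x" by (simp add: limiting_subdiff_def)
qed

text \<open>
  A differentiable minorant that touches \<open>g\<close> at \<open>x\<close> and has zero derivative there. This replaces sum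
  and chain rules for the subdifferential.
\<close>

lemma zero_in_frechet_subdiff_support:
  fixes g p :: "'a::euclidean_space \<Rightarrow> real"
  assumes p: "(p has_derivative (\<lambda>h. 0)) (at x)" and le: "\<And>y. p y \<le> g y" and eq: "p x = g x"
  shows "0 \<in> frechet_subdiff (\<lambda>y. ereal (g y)) x"
proof (rule frechet_subdiffI)
  fix e :: real assume "0 < e"
  have "((\<lambda>y. \<bar>p y - p x\<bar> / norm (y - x)) \<longlongrightarrow> 0) (at x)"
    using p by (simp add: has_derivative_iff_norm)
  then have "\<forall>\<^sub>F y in at x. \<bar>p y - p x\<bar> / norm (y - x) < e"
    using \<open>0 < e\<close> by (rule order_tendstoD)
  moreover have "\<forall>\<^sub>F y in at x. y \<noteq> x" by (simp add: eventually_at_filter)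
  ultimately have "\<forall>\<^sub>F y in at x. \<bar>p y - p x\<bar> \<le> e * norm (y - x)"
    by eventually_elim (simp add: field_simps)
  then show "\<forall>\<^sub>F y in at x. g y - g x - 0 \<bullet> (y - x) \<ge> - e * norm (y - x)"
  proof eventually_elim
    case (elim y)
    then show ?case using le[of y] eq by simp
  qed
qed

text \<open>
  As \<open>\<theta>\<close> is nonnegative on norms, the zero function is a minorant that touches at \<open>0\<close>.
\<close>

lemma zero_in_limiting_subdiff_theta_norm:
  assumes th: "theta_cond \<theta>"
  shows "0 \<in> limiting_subdiff (\<lambda>y :: 'a::euclidean_space. \<theta> (norm y)) 0"
proof -
  have "0 \<in> frechet_subdiff (\<lambda>y :: 'a. ereal (real_of_ereal (\<theta> (norm y)))) 0"
    by (rule zero_in_frechet_subdiff_support[of "\<lambda>_. 0"])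
      (simp_all add: theta_cond_nonneg[OF th] theta_cond_zero[OF th])
  then show ?thesis
    using frechet_subset_limiting_subdiff theta_cond_finite[OF th]
    by (metis (no_types, lifting) ext norm_ge_zero subsetD)
qed

text \<open>
  In the application, \<open>H\<close> is the gradient of \<open>f(U V\<^sup>T)\<close> with respect to the factor \<open>A\<close>. At zero
  columns the selected subgradient is \<open>0\<close>.
\<close>

lemma col_subdiff_selection:
  fixes A H :: "('l::finite, 'r::finite) rmat"
  assumes th: "theta_cond \<theta>" and lam: "0 < lam"
    and nz: "\<And>j. column j A \<noteq> 0 \<Longrightarrow>
      column j H + column_weight \<theta> lam mu (norm (column j A)) *\<^sub>R column j A = 0"
    and z: "\<And>j. column j A = 0 \<Longrightarrow> column j H = 0"
  obtains M where "H + mu *\<^sub>R A + lam *\<^sub>R M = 0" "\<And>j. column j M \<in> col_subdiff \<theta> (column j A)"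
proof
  define M where "M = (- 1 / lam) *\<^sub>R (H + mu *\<^sub>R A)"
  show "H + mu *\<^sub>R A + lam *\<^sub>R M = 0"
    using lam by (simp add: M_def)
  fix j
  have col: "column j M = (- 1 / lam) *\<^sub>R (column j H + mu *\<^sub>R column j A)"
    by (simp add: M_def column_def vec_eq_iff)
  show "column j M \<in> col_subdiff \<theta> (column j A)"
  proof (cases "column j A = 0")
    case True
    then show ?thesis
      by (simp add: col z col_subdiff_def zero_in_limiting_subdiff_theta_norm[OF th])
  next
    case False
    let ?w = "deriv (\<lambda>t. real_of_ereal (\<theta> t)) (norm (column j A)) / norm (column j A)"
    have "column j H = - ((mu + lam * ?w) *\<^sub>R column j A)"
      using nz[OF False] by (simp add: column_weight_def eq_neg_iff_add_eq_0)
    then have "column j M = (- 1 / lam) *\<^sub>R (- (lam * ?w) *\<^sub>R column j A)"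
      unfolding col by (simp add: scaleR_left_distrib)
    then show ?thesis using False lam by (simp add: col_subdiff_def)
  qed
qed

text \<open>
  Dropping the columns in which \<open>A\<close> vanishes removes the terms that may fail to be differentiable
  at \<open>A\<close>. As \<open>\<theta>\<close> is nonnegative, what remains is a minorant that touches the full regularizer at
  \<open>A\<close>.
\<close>

definition support_reg :: "(real \<Rightarrow> ereal) \<Rightarrow> real \<Rightarrow> real \<Rightarrow> ('l::finite, 'r::finite) rmat \<Rightarrow> ('l, 'r) rmat \<Rightarrow> real"
where
  "support_reg \<theta> lam mu A W = mu / 2 * (norm W)\<^sup>2
     + lam * (\<Sum>j | column j A \<noteq> 0. real_of_ereal (\<theta> (norm (column j W))))"

lemma support_reg_le:
  assumes "theta_cond \<theta>" "0 < lam"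
  shows "support_reg \<theta> lam mu A W \<le> mu / 2 * (norm W)\<^sup>2 + lam * reg \<theta> W"
  unfolding support_reg_def reg_def using assms
  by (auto intro!: mult_left_mono sum_mono2 simp: theta_cond_nonneg)

lemma support_reg_eq:
  assumes "theta_cond \<theta>"
  shows "support_reg \<theta> lam mu A A = mu / 2 * (norm A)\<^sup>2 + lam * reg \<theta> A"
proof -
  have "(\<Sum>j | column j A \<noteq> 0. real_of_ereal (\<theta> (norm (column j A)))) = reg \<theta> A"
    unfolding reg_def by (rule sum.mono_neutral_left) (auto simp: theta_cond_zero[OF assms])
  then show ?thesis by (simp add: support_reg_def)
qed

lemma support_reg_has_derivative:
  fixes A H :: "('l::finite, 'r::finite) rmat"
  assumes th: "theta_cond \<theta>"
    and nz: "\<And>j. column j A \<noteq> 0 \<Longrightarrow>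
      column j H + column_weight \<theta> lam mu (norm (column j A)) *\<^sub>R column j A = 0"
    and z: "\<And>j. column j A = 0 \<Longrightarrow> column j H = 0"
  shows "(support_reg \<theta> lam mu A has_derivative (\<lambda>h. - (H \<bullet> h))) (at A)"
proof -
  let ?th = "\<lambda>s. real_of_ereal (\<theta> s)" and ?J = "{j. column j A \<noteq> 0}"
  let ?w = "\<lambda>j. deriv ?th (norm (column j A)) / norm (column j A)"
  have col: "((\<lambda>W. ?th (norm (column j W))) has_derivative (\<lambda>h. ?w j * (column j A \<bullet> column j h))) (at A)"
    if "j \<in> ?J" for j
    by (rule has_derivative_compose[OF bounded_linear_imp_has_derivative[OF bounded_linear_column]
          has_derivative_theta_norm[OF th]]) (use that in simp)
  have sq: "((\<lambda>W. (norm W)\<^sup>2) has_derivative (\<lambda>h. 2 * (A \<bullet> h))) (at A)"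
    unfolding power2_norm_eq_inner by (auto intro!: derivative_eq_intros simp: inner_commute)
  have "(support_reg \<theta> lam mu A has_derivative
      (\<lambda>h. mu / 2 * (2 * (A \<bullet> h)) + lam * (\<Sum>j\<in>?J. ?w j * (column j A \<bullet> column j h)))) (at A)"
    unfolding support_reg_def
    by (intro has_derivative_add has_derivative_mult_right has_derivative_sum col sq)
  moreover have "mu / 2 * (2 * (A \<bullet> h)) + lam * (\<Sum>j\<in>?J. ?w j * (column j A \<bullet> column j h)) = - (H \<bullet> h)" for h
  proof -
    have "(\<Sum>j\<in>?J. ?w j * (column j A \<bullet> column j h)) = (\<Sum>j\<in>UNIV. ?w j * (column j A \<bullet> column j h))"
      by (rule sum.mono_neutral_left) auto
    then have "mu / 2 * (2 * (A \<bullet> h)) + lam * (\<Sum>j\<in>?J. ?w j * (column j A \<bullet> column j h))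
        = (\<Sum>j\<in>UNIV. mu * (column j A \<bullet> column j h) + lam * (?w j * (column j A \<bullet> column j h)))"
      by (simp add: inner_columns sum_distrib_left sum.distrib)
    also have "\<dots> = (\<Sum>j\<in>UNIV. - (column j H \<bullet> column j h))"
    proof (rule sum.cong[OF refl])
      fix j
      have "column j H = - ((mu + lam * ?w j) *\<^sub>R column j A)"
        using nz[of j] z[of j]
        by (cases "column j A = 0") (auto simp: column_weight_def eq_neg_iff_add_eq_0)
      then have "column j H \<bullet> column j h = - ((mu + lam * ?w j) * (column j A \<bullet> column j h))"
        by simp
      then show "mu * (column j A \<bullet> column j h) + lam * (?w j * (column j A \<bullet> column j h))
          = - (column j H \<bullet> column j h)"
        by (simp only: distrib_right mult.assoc minus_minus)
    qed
    finally show ?thesis by (simp add: inner_columns sum_negf)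
  qed
  ultimately show ?thesis by simp
qed

text \<open>
  The column equations provide the selections for the product formula. They also say that the
  differentiable minorant of the objective built from \<open>support_reg\<close> has zero derivative at \<open>(U, V)\<close>,
  so \<open>0\<close> is even a Frechet subgradient of the objective.
\<close>

lemma stationary_pointI:
  fixes U :: "('n::finite, 'r::finite) rmat" and V :: "('m::finite, 'r) rmat"
  assumes th: "theta_cond \<theta>" and lam: "0 < lam"
    and f: "GDERIV f (U ** transpose V) :> gf (U ** transpose V)"
    and supp: "\<And>j. column j U = 0 \<longleftrightarrow> column j V = 0"
    and eqU: "\<And>j. column j U \<noteq> 0 \<Longrightarrow> gf (U ** transpose V) *v column j V
                + column_weight \<theta> lam mu (norm (column j U)) *\<^sub>R column j U = 0"
    and eqV: "\<And>j. column j V \<noteq> 0 \<Longrightarrow> transpose (gf (U ** transpose V)) *v column j U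
                + column_weight \<theta> lam mu (norm (column j V)) *\<^sub>R column j V = 0"
  shows "stationary_point f gf \<theta> lam mu U V"
proof -
  let ?G = "gf (U ** transpose V)"
  let ?HU = "?G ** V" and ?HV = "transpose ?G ** U"
  have nzU: "column j ?HU + column_weight \<theta> lam mu (norm (column j U)) *\<^sub>R column j U = 0"
    if "column j U \<noteq> 0" for j
    using eqU[OF that] by (simp only: column_mult)
  have nzV: "column j ?HV + column_weight \<theta> lam mu (norm (column j V)) *\<^sub>R column j V = 0"
    if "column j V \<noteq> 0" for j
    using eqV[OF that] by (simp only: column_mult)
  have zU: "column j ?HU = 0" if "column j U = 0" for j
    using that supp by (simp add: column_mult)
  have zV: "column j ?HV = 0" if "column j V = 0" for j
  proof -
    have "column j U = 0" using that supp by simp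
    then show ?thesis by (simp only: column_mult matrix_vector_mult_0_right)
  qed
  obtain M where "?HU + mu *\<^sub>R U + lam *\<^sub>R M = 0" "\<And>j. column j M \<in> col_subdiff \<theta> (column j U)"
    using col_subdiff_selection[OF th lam nzU zU] by blast
  moreover obtain N where "?HV + mu *\<^sub>R V + lam *\<^sub>R N = 0" "\<And>j. column j N \<in> col_subdiff \<theta> (column j V)"
    using col_subdiff_selection[OF th lam nzV zV] by blast
  ultimately have "0 \<in> Phi_subdiff gf \<theta> lam mu U V"
    unfolding Phi_subdiff_def zero_prod_def mem_Times_iff fst_conv snd_conv mem_Collect_eq by metis
  define p where "p = (\<lambda>(W, Z). f (W ** transpose Z) + (support_reg \<theta> lam mu U W + support_reg \<theta> lam mu V Z))"
  have "((\<lambda>z. f (fst z ** transpose (snd z)) + (support_reg \<theta> lam mu U (fst z) + support_reg \<theta> lam mu V (snd z)))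
      has_derivative (\<lambda>h. (U ** transpose (snd h) + fst h ** transpose V) \<bullet> ?G
        + (- (?HU \<bullet> fst h) + - (?HV \<bullet> snd h)))) (at (U, V))"
  proof (intro has_derivative_add)
    have "((\<lambda>z. fst z ** transpose (snd z)) has_derivative
        (\<lambda>h. fst (U, V) ** transpose (snd h) + fst h ** transpose (snd (U, V)))) (at (U, V))"
      by (rule bounded_bilinear.FDERIV[OF bounded_bilinear_mult_transpose])
        (auto intro: derivative_intros)
    moreover have "(f has_derivative (\<lambda>h. h \<bullet> ?G)) (at (fst (U, V) ** transpose (snd (U, V))))"
      using f by (simp add: gderiv_def)
    ultimately have "((\<lambda>z. f (fst z ** transpose (snd z))) has_derivative
        (\<lambda>h. (fst (U, V) ** transpose (snd h) + fst h ** transpose (snd (U, V))) \<bullet> ?G)) (at (U, V))"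
      by (rule has_derivative_compose)
    then show "((\<lambda>z. f (fst z ** transpose (snd z))) has_derivative
        (\<lambda>h. (U ** transpose (snd h) + fst h ** transpose V) \<bullet> ?G)) (at (U, V))" by simp
    have "(support_reg \<theta> lam mu U has_derivative (\<lambda>h. - (?HU \<bullet> h))) (at (fst (U, V)))"
      using support_reg_has_derivative[OF th nzU zU] by simp
    from has_derivative_compose[OF has_derivative_fst[OF has_derivative_ident] this]
    show "((\<lambda>z. support_reg \<theta> lam mu U (fst z)) has_derivative (\<lambda>h. - (?HU \<bullet> fst h))) (at (U, V))" .
    have "(support_reg \<theta> lam mu V has_derivative (\<lambda>h. - (?HV \<bullet> h))) (at (snd (U, V)))"
      using support_reg_has_derivative[OF th nzV zV] by simp
    from has_derivative_compose[OF has_derivative_snd[OF has_derivative_ident] this]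
    show "((\<lambda>z. support_reg \<theta> lam mu V (snd z)) has_derivative (\<lambda>h. - (?HV \<bullet> snd h))) (at (U, V))" .
  qed
  moreover have "(U ** transpose K + H ** transpose V) \<bullet> ?G + (- (?HU \<bullet> H) + - (?HV \<bullet> K)) = 0" for H K
  proof -
    have "(H ** transpose V) \<bullet> ?G = ?HU \<bullet> H"
      by (metis inner_commute inner_mult_transpose)
    moreover have "(U ** transpose K) \<bullet> ?G = ?HV \<bullet> K"
      by (metis inner_commute inner_mult_transpose inner_transpose mult_transpose_swap transpose_transpose)
    ultimately show ?thesis by (simp add: inner_add_left)
  qed
  ultimately have "(p has_derivative (\<lambda>h. 0)) (at (U, V))"
    by (simp add: p_def case_prod_unfold)
  moreover have "p z \<le> objective f \<theta> lam mu (fst z) (snd z)" for z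
    using support_reg_le[OF th lam, of mu U "fst z"] support_reg_le[OF th lam, of mu V "snd z"]
    by (simp add: p_def case_prod_unfold objective_def algebra_simps)
  moreover have "p (U, V) = objective f \<theta> lam mu (fst (U, V)) (snd (U, V))"
    by (simp add: p_def objective_def support_reg_eq[OF th] algebra_simps)
  ultimately have "0 \<in> frechet_subdiff (\<lambda>z. ereal (objective f \<theta> lam mu (fst z) (snd z))) (U, V)"
    by (rule zero_in_frechet_subdiff_support)
  then have "0 \<in> limiting_subdiff (\<lambda>z. ereal (objective f \<theta> lam mu (fst z) (snd z))) (U, V)"
    by (rule subsetD[OF frechet_subset_limiting_subdiff])
  then have "0 \<in> limiting_subdiff (\<lambda>(W, Z). Phi f \<theta> lam mu W Z) (U, V)"
    by (simp add: Phi_eq[OF th] case_prod_unfold)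
  with \<open>0 \<in> Phi_subdiff gf \<theta> lam mu U V\<close> show ?thesis
    by (simp add: stationary_point_def)
qed


section \<open>Balanced factors from thin singular value decompositions\<close>

lemma balanced_objective_le:
  fixes U U' :: "('n::{finite,linorder}, 'r::{finite,linorder}) rmat"
    and V V' :: "('m::{finite,linorder}, 'r) rmat"
  assumes dims: "CARD('r) \<le> CARD('n)" "CARD('n) \<le> CARD('m)"
    and optimal: "svd_factorization_optimal \<theta> TYPE('n) TYPE('m)"
    and th: "theta_cond \<theta>" and lam: "0 < lam" and mu: "0 < mu"
    and bal: "balanced_svd U V P Q d"
    and eq: "U ** transpose V = U' ** transpose V'"
  shows "objective f \<theta> lam mu U V \<le> objective f \<theta> lam mu U' V'"
proof -
  have "reg \<theta> U + reg \<theta> V \<le> reg \<theta> U' + reg \<theta> V'"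
    using balanced_svd_vartheta_le[OF dims optimal bal eq] by (simp add: vartheta_mat_eq[OF th])
  then have "lam * (reg \<theta> U + reg \<theta> V) \<le> lam * (reg \<theta> U' + reg \<theta> V')"
    using lam by (intro mult_left_mono) auto
  moreover have "mu / 2 * ((norm U)\<^sup>2 + (norm V)\<^sup>2) \<le> mu / 2 * ((norm U')\<^sup>2 + (norm V')\<^sup>2)"
    using mu balanced_svd_norm_le[OF bal eq] by (intro mult_left_mono) auto
  ultimately show ?thesis
    unfolding objective_def eq by linarith
qed

lemma balanced_svd_reg_eq: "balanced_svd U V P Q d \<Longrightarrow> reg \<theta> U = reg \<theta> V"
  by (simp add: reg_def balanced_svd_column_norms)

text \<open>
  The diagonal of \<open>D\<^sup>2\<close> lists entries of \<open>singular_values A\<close>, a list that is sorted by definition. Its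
  length has to be known for the entries to be meaningful, and the eigenbasis given by the columns
  of \<open>Q\<close> provides it.
\<close>

lemma thin_svd_diag_antimono:
  fixes D :: "('r::{finite,linorder}, 'r) rmat"
  assumes svd: "thin_svd A P (D ** D) Q" and D: "nonneg_diag D" and ij: "i \<le> j"
  shows "D $ j $ j \<le> D $ i $ i"
proof -
  have P: "orthonormal_cols P" and Q: "orthogonal_matrix Q"
    and S: "D ** D = rect_diag (sv A)" and A: "A = (P ** (D ** D)) ** transpose Q"
    using svd unfolding thin_svd_def by blast+
  have oQ: "orthonormal_cols Q" using Q by (simp add: orthonormal_cols_def orthogonal_matrix)
  have "(D ** D) $ k $ k = (D $ k $ k)\<^sup>2" for k
    using nonneg_diag_mult_column[OF D, of k D]
    by (simp add: column_def vec_eq_iff power2_eq_square)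
  then have sv: "sv A (pos k) = (D $ k $ k)\<^sup>2" for k
    unfolding S by (simp add: rect_diag_def)
  have col: "column k (P ** (D ** D)) = (D $ k $ k)\<^sup>2 *\<^sub>R column k P" for k
    by (simp add: matrix_mul_assoc nonneg_diag_mult_column[OF D] power2_eq_square)
  have AQ: "A *v column k Q = (D $ k $ k)\<^sup>2 *\<^sub>R column k P" for k
  proof -
    have "(column l Q \<bullet> column k Q) *\<^sub>R column l (P ** (D ** D))
        = (if l = k then (D $ k $ k)\<^sup>2 *\<^sub>R column k P else 0)" for l
      using oQ by (simp add: orthonormal_cols_iff col)
    then show ?thesis by (simp add: A mult_transpose_vec)
  qed
  have AP: "transpose A *v column k P = (D $ k $ k)\<^sup>2 *\<^sub>R column k Q" for k
  proof -
    have "transpose A = Q ** transpose (P ** (D ** D))"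
      by (simp only: A matrix_transpose_mul transpose_transpose)
    moreover have "(column l (P ** (D ** D)) \<bullet> column k P) *\<^sub>R column l Q
        = (if l = k then (D $ k $ k)\<^sup>2 *\<^sub>R column k Q else 0)" for l
      using P by (simp add: orthonormal_cols_iff col)
    ultimately show ?thesis by (simp only: mult_transpose_vec) simp
  qed
  have AA: "(transpose A ** A) *v column k Q = ((D $ k $ k)\<^sup>2)\<^sup>2 *\<^sub>R column k Q" for k
  proof -
    have "(transpose A ** A) *v column k Q = transpose A *v (A *v column k Q)"
      by (rule matrix_vector_mul_assoc[symmetric])
    then show ?thesis
      unfolding AQ matrix_vector_mult_scaleR AP by (simp add: power2_eq_square)
  qed
  have "(D $ j $ j)\<^sup>2 \<le> (D $ i $ i)\<^sup>2"
    using sv_antimono[OF Q AA ij] by (simp add: sv)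
  then show ?thesis using D by (auto simp: nonneg_diag_def intro: power2_le_imp_le)
qed

lemma balanced_svd_scaled:
  fixes P :: "('n::{finite,linorder}, 'r::{finite,linorder}) rmat" and Q :: "('m::{finite,linorder}, 'r) rmat"
  assumes "orthonormal_cols P" "orthonormal_cols Q" "nonneg_diag D" "thin_svd A P' (D ** D) Q'"
  shows "balanced_svd (P ** D) (Q ** D) P Q (\<lambda>j. D $ j $ j)"
  using assms thin_svd_diag_antimono[OF assms(4,3)]
  by (auto simp: balanced_svd_def nonneg_diag_mult_column nonneg_diag_def)

lemma balanced_stationary_point:
  fixes U :: "('n::{finite,linorder}, 'r::{finite,linorder}) rmat" and V :: "('m::{finite,linorder}, 'r) rmat"
  assumes th: "theta_cond \<theta>" and lam: "0 < lam"
    and f: "GDERIV f (U ** transpose V) :> gf (U ** transpose V)"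
    and bal: "balanced_svd U V P Q d"
    and eqU: "\<And>j. d j \<noteq> 0 \<Longrightarrow> gf (U ** transpose V) *v column j Q = - column_weight \<theta> lam mu (d j) *\<^sub>R column j P"
    and eqV: "\<And>j. d j \<noteq> 0 \<Longrightarrow> transpose (gf (U ** transpose V)) *v column j P
                = - column_weight \<theta> lam mu (d j) *\<^sub>R column j Q"
  shows "stationary_point f gf \<theta> lam mu U V"
proof (rule stationary_pointI[where f = f and gf = gf and U = U and V = V, OF th lam f])
  have U: "column j U = d j *\<^sub>R column j P" and V: "column j V = d j *\<^sub>R column j Q" for j
    using bal by (auto simp: balanced_svd_def)
  have nz: "column j U \<noteq> 0 \<longleftrightarrow> d j \<noteq> 0" "column j V \<noteq> 0 \<longleftrightarrow> d j \<noteq> 0" for j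
    using balanced_svd_column_norms[OF bal, of j] by (metis norm_eq_zero)+
  show "column j U = 0 \<longleftrightarrow> column j V = 0" for j using nz by blast
  show "gf (U ** transpose V) *v column j V + column_weight \<theta> lam mu (norm (column j U)) *\<^sub>R column j U = 0"
    if "column j U \<noteq> 0" for j
    using eqU[of j] that
    unfolding nz balanced_svd_column_norms[OF bal] unfolding U V matrix_vector_mult_scaleR by simp
  show "transpose (gf (U ** transpose V)) *v column j U
      + column_weight \<theta> lam mu (norm (column j V)) *\<^sub>R column j V = 0"
    if "column j V \<noteq> 0" for j
  proof -
    have "d j \<noteq> 0" using that nz by blast
    from eqV[OF this] have "transpose (gf (U ** transpose V)) *v column j U
        = d j *\<^sub>R (- column_weight \<theta> lam mu (d j) *\<^sub>R column j Q)"
      by (simp only: U matrix_vector_mult_scaleR)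
    then show ?thesis unfolding balanced_svd_column_norms[OF bal] by (simp add: V)
  qed
qed


section \<open>Convergence of the alternating scheme\<close>

lemma GDERIV_isCont: "GDERIV f X :> G \<Longrightarrow> isCont f X"
  unfolding gderiv_def by (rule has_derivative_continuous)

lemma tendsto_objective:
  assumes f: "isCont f (A' ** transpose B')"
    and A: "A \<longlonglongrightarrow> A'" and B: "B \<longlonglongrightarrow> B'"
    and reg: "(\<lambda>k. reg \<theta> (A k)) \<longlonglongrightarrow> reg \<theta> A'" "(\<lambda>k. reg \<theta> (B k)) \<longlonglongrightarrow> reg \<theta> B'"
  shows "(\<lambda>k. objective f \<theta> lam mu (A k) (B k)) \<longlonglongrightarrow> objective f \<theta> lam mu A' B'"
  unfolding objective_def
  by (intro tendsto_intros reg A B isCont_tendsto_compose[OF f] tendsto_mult_transpose)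

text \<open>
  The regularizer converges along the updated factor \<open>Ap\<close> by \<open>proximal_step_limit\<close>. A vanishing decrease
  of the objective carries this over to the factor \<open>A\<close> before the step, since all other terms of the
  objective are continuous.
\<close>

lemma alternating_step_limit:
  fixes A Ap :: "nat \<Rightarrow> ('n::finite, 'r::finite) rmat" and B :: "nat \<Rightarrow> ('m::finite, 'r) rmat"
  assumes th: "theta_cond \<theta>" and lam: "0 < lam"
    and f: "\<And>X. GDERIV f X :> gf X" and lip: "L-lipschitz_on UNIV gf"
    and A: "A \<longlonglongrightarrow> A'" and B: "B \<longlonglongrightarrow> B'" and Ap: "(\<lambda>k. Ap k - A k) \<longlonglongrightarrow> 0"
    and g: "\<And>k. 0 \<le> g k" "\<And>k. g k \<le> C"
    and min: "\<And>k W. proximal_model gf L \<theta> lam mu (g k) (A k) (B k) (Ap k)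
                  \<le> proximal_model gf L \<theta> lam mu (g k) (A k) (B k) W"
    and obj: "(\<lambda>k. objective f \<theta> lam mu (Ap k) (B k) - objective f \<theta> lam mu (A k) (B k)) \<longlonglongrightarrow> 0"
  shows "(\<lambda>k. reg \<theta> (A k)) \<longlonglongrightarrow> reg \<theta> A'"
    and "column j A' \<noteq> 0 \<Longrightarrow> gf (A' ** transpose B') *v column j B'
           + column_weight \<theta> lam mu (norm (column j A')) *\<^sub>R column j A' = 0"
proof -
  have L: "0 \<le> L" using lip by (rule lipschitz_on_nonneg)
  have cont: "continuous_on UNIV gf" using lip by (rule lipschitz_on_continuous_on)
  note limit = proximal_step_limit[OF th lam L cont A B Ap g min]
  show "gf (A' ** transpose B') *v column j B'
      + column_weight \<theta> lam mu (norm (column j A')) *\<^sub>R column j A' = 0" if "column j A' \<noteq> 0"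
    using proximal_model_minimizer_column[OF th limit(2) that] .
  have Ap': "Ap \<longlonglongrightarrow> A'" using tendsto_add[OF A Ap] by simp
  have fA: "(\<lambda>k. f (A k ** transpose (B k))) \<longlonglongrightarrow> f (A' ** transpose B')"
    by (intro isCont_tendsto_compose[OF GDERIV_isCont[OF f]] tendsto_mult_transpose A B)
  have fAp: "(\<lambda>k. f (Ap k ** transpose (B k))) \<longlonglongrightarrow> f (A' ** transpose B')"
    by (intro isCont_tendsto_compose[OF GDERIV_isCont[OF f]] tendsto_mult_transpose Ap' B)
  have "(\<lambda>k. reg \<theta> (Ap k) + (f (Ap k ** transpose (B k)) - f (A k ** transpose (B k))
        + mu / 2 * ((norm (Ap k))\<^sup>2 - (norm (A k))\<^sup>2)
        - (objective f \<theta> lam mu (Ap k) (B k) - objective f \<theta> lam mu (A k) (B k))) / lam)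
      \<longlonglongrightarrow> reg \<theta> A' + (f (A' ** transpose B') - f (A' ** transpose B')
        + mu / 2 * ((norm A')\<^sup>2 - (norm A')\<^sup>2) - 0) / lam"
    using lam by (intro tendsto_intros limit(1) fA fAp obj Ap' A) simp
  moreover have "reg \<theta> (Ap k) + (f (Ap k ** transpose (B k)) - f (A k ** transpose (B k))
        + mu / 2 * ((norm (Ap k))\<^sup>2 - (norm (A k))\<^sup>2)
        - (objective f \<theta> lam mu (Ap k) (B k) - objective f \<theta> lam mu (A k) (B k))) / lam = reg \<theta> (A k)" for k
    using lam by (simp add: objective_def field_simps)
  ultimately show "(\<lambda>k. reg \<theta> (A k)) \<longlonglongrightarrow> reg \<theta> A'" by simp
qed

lemma damped_weight_bounds:
  fixes g :: "nat \<Rightarrow> real"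
  assumes "0 < rho" "rho < 1" "0 < low" "0 < g 0" "\<And>k. g (Suc k) = max low (rho * g k)"
  shows "min low (g 0) \<le> g k" "g k \<le> max low (g 0)"
proof (induction k)
  case (Suc k)
  case 2
  have "0 < g k" using Suc(1) assms by auto
  then have "rho * g k \<le> g k" using assms(2) by simp
  then show ?case using Suc(2) assms(5)[of k] by auto
qed (use assms(5) in auto)

lemma steps_vanish:
  fixes x :: "nat \<Rightarrow> 'a::real_normed_vector"
  assumes "0 < c" "\<And>k. c \<le> g k" "\<And>k. g k / 2 * (norm (x k))\<^sup>2 \<le> e k" "e \<longlonglongrightarrow> 0"
  shows "x \<longlonglongrightarrow> 0"
proof -
  have bound: "(norm (x k))\<^sup>2 \<le> e k * (2 / c)" for k
  proof -
    have "c / 2 * (norm (x k))\<^sup>2 \<le> e k"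
      using assms(2)[of k] by (intro order_trans[OF mult_right_mono assms(3)]) auto
    then show ?thesis using assms(1) by (simp add: field_simps)
  qed
  have "(\<lambda>k. (norm (x k))\<^sup>2) \<longlonglongrightarrow> 0"
  proof (rule Lim_null_comparison)
    show "\<forall>\<^sub>F k in sequentially. norm ((norm (x k))\<^sup>2) \<le> e k * (2 / c)"
      using bound by simp
    show "(\<lambda>k. e k * (2 / c)) \<longlonglongrightarrow> 0"
      by (rule tendsto_mult_left_zero[OF assms(4)])
  qed
  then have "(\<lambda>k. sqrt ((norm (x k))\<^sup>2)) \<longlonglongrightarrow> sqrt 0" by (rule tendsto_real_sqrt)
  then show ?thesis by (simp add: tendsto_norm_zero_iff)
qed

theorem theorem5:
  fixes f :: "('n::{finite,linorder}, 'm::{finite,linorder}) rmat \<Rightarrow> real"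
    and gf :: "('n, 'm) rmat \<Rightarrow> ('n, 'm) rmat"
    and \<theta> :: "real \<Rightarrow> ereal"
    and L lam mu rho g1low g2low :: real
    and g1 g2 :: "nat \<Rightarrow> real"
    and U Ph Uh Ub :: "nat \<Rightarrow> ('n, 'r::{finite,linorder}) rmat"
    and V Pb Vh Vb :: "nat \<Rightarrow> ('m, 'r) rmat"
    and Dh Qh Db Qb :: "nat \<Rightarrow> ('r, 'r) rmat"
    and Xh Xb :: "nat \<Rightarrow> ('n, 'm) rmat"
  assumes dims: "CARD('r) \<le> CARD('n)" "CARD('n) \<le> CARD('m)"
    and lam: "0 < lam" and mu: "0 < mu"
    and f_bounded_below: "bdd_below (range f)"
    and f_gradient: "\<And>X. GDERIV f X :> gf X"
    and f_lipschitz: "L-lipschitz_on UNIV gf"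
    and theta: "theta_cond \<theta>"
    and optimal: "svd_factorization_optimal \<theta> TYPE('n) TYPE('m)"
    and run: "algorithm_run f gf L \<theta> lam mu rho g1low g2low g1 g2
                U V Ph Dh Qh Pb Db Qb Uh Vh Xh Ub Vb Xb"
  shows "\<exists>\<omega>::real.
    (\<lambda>k. Phi f \<theta> lam mu (Ub k) (Vb k)) \<longlonglongrightarrow> ereal \<omega> \<and>
    (\<lambda>k. Phi f \<theta> lam mu (Uh (Suc k)) (Vh (Suc k))) \<longlonglongrightarrow> ereal \<omega> \<and>
    (\<forall>(Uh', Vh', Ub', Vb', Xh', Xb') \<in> cluster_points
         (\<lambda>k. (Uh (Suc k), Vh (Suc k), Ub (Suc k), Vb (Suc k), Xh (Suc k), Xb (Suc k))).
       stationary_point f gf \<theta> lam mu Ub' Vb' \<and>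
       stationary_point f gf \<theta> lam mu Uh' Vh' \<and>
       Phi f \<theta> lam mu Ub' Vb' = ereal \<omega> \<and>
       Phi f \<theta> lam mu Uh' Vh' = ereal \<omega>)"
proof -
  have th: "theta_cond \<theta>" by (rule theta)
  let ?ft = "\<lambda>X. f (transpose X)" and ?gt = "\<lambda>X. transpose (gf (transpose X))"
  let ?obj = "objective f \<theta> lam mu"
  note run = run[unfolded algorithm_run_def]
  have rho: "0 < rho" "rho < 1" and low: "0 < g1low" "0 < g2low" and init: "0 < g1 0" "0 < g2 0"
    using run by blast+
  have g1_Suc: "g1 (Suc k) = max g1low (rho * g1 k)" and g2_Suc: "g2 (Suc k) = max g2low (rho * g2 k)" for k
    using run by blast+
  \<comment> \<open>The initial values \<open>Db 0 = mat 1\<close> and \<open>Vb 0 = Pb 0\<close> fit the pattern of the later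
    iterates.\<close>
  have Db: "nonneg_diag (Db k)" for k
    using run by (cases k) (auto simp: nonneg_diag_def mat_def)
  have Dh: "nonneg_diag (Dh (Suc k))" for k using run by blast
  have svdU: "thin_svd (U (Suc k) ** Db k) (Ph (Suc k)) (Dh (Suc k) ** Dh (Suc k)) (Qh (Suc k))" for k
    using run by blast
  have svdV: "thin_svd (V (Suc k) ** Dh (Suc k)) (Pb (Suc k)) (Db (Suc k) ** Db (Suc k)) (Qb (Suc k))" for k
    using run by blast
  have Pb: "orthonormal_cols (Pb k)" for k
  proof (cases k)
    case 0
    then show ?thesis using run by blast
  next
    case (Suc l)
    then show ?thesis using svdV[of l] unfolding thin_svd_def by blast
  qed
  have Ph: "orthonormal_cols (Ph (Suc k))" and Qh: "orthogonal_matrix (Qh (Suc k))" for k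
    using svdU[of k] unfolding thin_svd_def by blast+
  have Qb: "orthogonal_matrix (Qb (Suc k))" for k
    using svdV[of k] unfolding thin_svd_def by blast
  have Uh: "Uh (Suc k) = Ph (Suc k) ** Dh (Suc k)" and Vh: "Vh (Suc k) = Pb k ** Qh (Suc k) ** Dh (Suc k)"
    and Ub: "Ub (Suc k) = Ph (Suc k) ** Qb (Suc k) ** Db (Suc k)"
    and Vb_Suc: "Vb (Suc k) = Pb (Suc k) ** Db (Suc k)" for k
    using run by blast+
  have Vb: "Vb k = Pb k ** Db k" for k
  proof (cases k)
    case 0
    have "Vb 0 = Pb 0" "Db 0 = mat 1" using run by blast+
    then show ?thesis by (simp add: 0)
  qed (simp add: Vb_Suc)

  have balh: "balanced_svd (Uh (Suc k)) (Vh (Suc k)) (Ph (Suc k)) (Pb k ** Qh (Suc k))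
      (\<lambda>j. Dh (Suc k) $ j $ j)" for k
    unfolding Uh Vh by (rule balanced_svd_scaled[OF Ph orthonormal_cols_mult[OF Pb Qh] Dh svdU])
  have balb: "balanced_svd (Ub (Suc k)) (Vb (Suc k)) (Ph (Suc k) ** Qb (Suc k)) (Pb (Suc k))
      (\<lambda>j. Db (Suc k) $ j $ j)" for k
    unfolding Ub Vb by (rule balanced_svd_scaled[OF orthonormal_cols_mult[OF Ph Qb] Pb Db svdV])
  have prodh: "Uh (Suc k) ** transpose (Vh (Suc k)) = U (Suc k) ** transpose (Vb k)" for k
  proof -
    have "U (Suc k) ** Db k = Ph (Suc k) ** (Dh (Suc k) ** Dh (Suc k)) ** transpose (Qh (Suc k))"
      using svdU[of k] unfolding thin_svd_def by blast
    then show ?thesis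
      unfolding Uh Vh Vb
      by (simp add: matrix_transpose_mul nonneg_diag_transpose[OF Dh] nonneg_diag_transpose[OF Db]
          matrix_mul_assoc)
  qed
  have prodb: "Ub (Suc k) ** transpose (Vb (Suc k)) = Uh (Suc k) ** transpose (V (Suc k))" for k
  proof -
    have "V (Suc k) ** Dh (Suc k) = Pb (Suc k) ** (Db (Suc k) ** Db (Suc k)) ** transpose (Qb (Suc k))"
      using svdV[of k] unfolding thin_svd_def by blast
    then have "transpose (V (Suc k) ** Dh (Suc k))
        = transpose (Pb (Suc k) ** (Db (Suc k) ** Db (Suc k)) ** transpose (Qb (Suc k)))" by simp
    then have "Dh (Suc k) ** transpose (V (Suc k))
        = Qb (Suc k) ** Db (Suc k) ** Db (Suc k) ** transpose (Pb (Suc k))"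
      by (simp add: matrix_transpose_mul nonneg_diag_transpose[OF Dh] nonneg_diag_transpose[OF Db]
          matrix_mul_assoc)
    then show ?thesis
      unfolding Uh Ub Vb
      by (simp add: matrix_transpose_mul nonneg_diag_transpose[OF Db] flip: matrix_mul_assoc)
  qed

  have ft: "GDERIV ?ft X :> ?gt X" for X by (rule GDERIV_transpose[OF f_gradient])
  have lipt: "L-lipschitz_on UNIV ?gt" by (rule lipschitz_transpose[OF f_lipschitz])
  have minU: "proximal_model gf L \<theta> lam mu (g1 k) (Ub k) (Vb k) (U (Suc k))
      \<le> proximal_model gf L \<theta> lam mu (g1 k) (Ub k) (Vb k) W" for k W
    by (rule argmin_proximal_model[OF th, of f]) (use run in blast)
  have minV: "proximal_model ?gt L \<theta> lam mu (g2 k) (Vh (Suc k)) (Uh (Suc k)) (V (Suc k))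
      \<le> proximal_model ?gt L \<theta> lam mu (g2 k) (Vh (Suc k)) (Uh (Suc k)) W" for k W
  proof (rule argmin_proximal_model[OF th, of ?ft])
    have "is_arg_min (\<lambda>W. Phi_hat f gf L \<theta> lam mu (Uh (Suc k)) W (Uh (Suc k)) (Vh (Suc k))
        + ereal (g2 k / 2 * (norm (W - Vh (Suc k)))\<^sup>2)) (\<lambda>_. True) (V (Suc k))"
      using run by blast
    then show "is_arg_min (\<lambda>W. Phi_hat ?ft ?gt L \<theta> lam mu W (Uh (Suc k)) (Vh (Suc k)) (Uh (Suc k))
        + ereal (g2 k / 2 * (norm (W - Vh (Suc k)))\<^sup>2)) (\<lambda>_. True) (V (Suc k))"
      by (simp only: Phi_hat_swap[OF th, of f gf])
  qed

  \<comment> \<open>\<open>eU\<close> and \<open>eV\<close> are the decreases of the objective in the two proximal steps; the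
    remaining decreases up to \<open>b k\<close> and \<open>a (Suc k)\<close> come from rebalancing.\<close>
  define a where "a k = ?obj (Ub k) (Vb k)" for k
  define b where "b k = ?obj (Uh (Suc k)) (Vh (Suc k))" for k
  define eU where "eU k = a k - ?obj (U (Suc k)) (Vb k)" for k
  define eV where "eV k = b k - ?obj (Uh (Suc k)) (V (Suc k))" for k
  have stepU: "g1 k / 2 * (norm (U (Suc k) - Ub k))\<^sup>2 \<le> eU k" for k
    using proximal_step_descent[OF f_gradient f_lipschitz minU, of k] by (simp add: eU_def a_def)
  have stepV: "g2 k / 2 * (norm (V (Suc k) - Vh (Suc k)))\<^sup>2 \<le> eV k" for k
    using proximal_step_descent[OF ft lipt minV, of k] by (simp add: eV_def b_def objective_swap[of f])
  have eU_le: "eU k \<le> a k - b k" for k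
    using balanced_objective_le[OF dims optimal th lam mu balh[of k] prodh[of k], of f]
    by (simp add: eU_def b_def)
  have eV_le: "eV k \<le> b k - a (Suc k)" for k
    using balanced_objective_le[OF dims optimal th lam mu balb[of k] prodb[of k], of f]
    by (simp add: eV_def a_def)
  note weights1 = damped_weight_bounds[of rho g1low g1, OF rho low(1) init(1) g1_Suc]
  note weights2 = damped_weight_bounds[of rho g2low g2, OF rho low(2) init(2) g2_Suc]
  have g1_pos: "0 \<le> g1 k" and g2_pos: "0 \<le> g2 k" for k
    using weights1(1)[of k] weights2(1)[of k] low init by linarith+
  have eU_pos: "0 \<le> eU k" and eV_pos: "0 \<le> eV k" for k
    using stepU[of k] stepV[of k] g1_pos[of k] g2_pos[of k]
    by (meson divide_nonneg_nonneg mult_nonneg_nonneg order_trans zero_le_numeral zero_le_power2)+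

  obtain M where M: "\<And>X. M \<le> f X" using f_bounded_below by (auto simp: bdd_below_def)
  have "M \<le> a k" for k
    using M[of "Ub k ** transpose (Vb k)"] lam mu reg_nonneg[OF th, of "Ub k"] reg_nonneg[OF th, of "Vb k"]
    by (simp add: a_def objective_def add_increasing2)
  moreover have "decseq a"
    by (rule decseq_SucI) (use eU_le eV_le eU_pos eV_pos in \<open>smt (verit)\<close>)
  ultimately obtain \<omega> where a: "a \<longlonglongrightarrow> \<omega>" by (metis decseq_convergent)
  then have a_Suc: "(\<lambda>k. a (Suc k)) \<longlonglongrightarrow> \<omega>" by (rule LIMSEQ_Suc)
  have b: "b \<longlonglongrightarrow> \<omega>"
  proof (rule tendsto_sandwich[OF _ _ a_Suc a])
    show "\<forall>\<^sub>F k in sequentially. a (Suc k) \<le> b k"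
      using eV_le eV_pos by (intro always_eventually allI) (smt (verit))
    show "\<forall>\<^sub>F k in sequentially. b k \<le> a k"
      using eU_le eU_pos by (intro always_eventually allI) (smt (verit))
  qed
  have eU: "eU \<longlonglongrightarrow> 0"
    by (rule Lim_null_comparison[where g = "\<lambda>k. a k - b k"])
      (use tendsto_diff[OF a b] eU_le eU_pos in \<open>auto intro!: always_eventually\<close>)
  have eV: "eV \<longlonglongrightarrow> 0"
    by (rule Lim_null_comparison[where g = "\<lambda>k. b k - a (Suc k)"])
      (use tendsto_diff[OF b a_Suc] eV_le eV_pos in \<open>auto intro!: always_eventually\<close>)
  have dU: "(\<lambda>k. U (Suc k) - Ub k) \<longlonglongrightarrow> 0"
    by (rule steps_vanish[OF _ weights1(1) stepU eU]) (use low init in simp)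
  have dV: "(\<lambda>k. V (Suc k) - Vh (Suc k)) \<longlonglongrightarrow> 0"
    by (rule steps_vanish[OF _ weights2(1) stepV eV]) (use low init in simp)

  \<comment> \<open>The bar pair at index \<open>Suc (s i)\<close> starts the \<open>U\<close>-step of the next round, while the
    hat pair at the same index starts the \<open>V\<close>-step of the current one.\<close>
  have cluster: "stationary_point f gf \<theta> lam mu Ub' Vb' \<and> stationary_point f gf \<theta> lam mu Uh' Vh' \<and>
      ?obj Ub' Vb' = \<omega> \<and> ?obj Uh' Vh' = \<omega>"
    if s: "strict_mono s" and Uh': "(\<lambda>i. Uh (Suc (s i))) \<longlonglongrightarrow> Uh'" and Vh': "(\<lambda>i. Vh (Suc (s i))) \<longlonglongrightarrow> Vh'"
      and Ub': "(\<lambda>i. Ub (Suc (s i))) \<longlonglongrightarrow> Ub'" and Vb': "(\<lambda>i. Vb (Suc (s i))) \<longlonglongrightarrow> Vb'"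
    for s Uh' Vh' Ub' Vb'
  proof -
    have s': "strict_mono (\<lambda>i. Suc (s i))" using s by (simp add: strict_mono_def)
    note sub = LIMSEQ_subseq_LIMSEQ[OF _ s, unfolded o_def]
    note sub' = LIMSEQ_subseq_LIMSEQ[OF _ s', unfolded o_def]
    have objU: "(\<lambda>i. ?obj (U (Suc (Suc (s i)))) (Vb (Suc (s i))) - ?obj (Ub (Suc (s i))) (Vb (Suc (s i)))) \<longlonglongrightarrow> 0"
      using tendsto_minus[OF sub'[OF eU]] by (simp add: eU_def a_def)
    have objV: "(\<lambda>i. objective ?ft \<theta> lam mu (V (Suc (s i))) (Uh (Suc (s i)))
        - objective ?ft \<theta> lam mu (Vh (Suc (s i))) (Uh (Suc (s i)))) \<longlonglongrightarrow> 0"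
      using tendsto_minus[OF sub[OF eV]] by (simp add: eV_def b_def objective_swap[of f])
    note limU = alternating_step_limit[OF th lam f_gradient f_lipschitz Ub' Vb'
        sub'[OF dU] g1_pos weights1(2) minU objU]
    note limV = alternating_step_limit[OF th lam ft lipt Vh' Uh'
        sub[OF dV] g2_pos weights2(2) minV objV]
    obtain P Q d where bal: "balanced_svd Ub' Vb' P Q d"
      using balanced_svd_limit[OF balb Ub' Vb'] by blast
    obtain P2 Q2 d2 where bal2: "balanced_svd Uh' Vh' P2 Q2 d2"
      using balanced_svd_limit[OF balh Uh' Vh'] by blast
    have V': "(\<lambda>i. V (Suc (s i))) \<longlonglongrightarrow> Vh'"
      using tendsto_add[OF Vh' sub[OF dV]] by simp
    \<comment> \<open>The bar pair has the product of the hat factor with \<open>V (Suc (s i))\<close>, and the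
      latter has the same limit as \<open>Vh (Suc (s i))\<close>.\<close>
    have X: "Ub' ** transpose Vb' = Uh' ** transpose Vh'"
      by (rule LIMSEQ_unique[OF tendsto_mult_transpose[OF Ub' Vb']])
        (simp only: prodb tendsto_mult_transpose[OF Uh' V'])
    have "d2 = d" using balanced_svd_unique_values[OF dims bal bal2 X] by simp
    note bal' = bal2[unfolded this]
    let ?G = "gf (Ub' ** transpose Vb')" and ?c = "\<lambda>t. - column_weight \<theta> lam mu t"
    have GQ: "?G *v column j Q = ?c (d j) *\<^sub>R column j P" if "d j \<noteq> 0" for j
    proof -
      have "column j Ub' \<noteq> 0" using balanced_svd_column_norms(1)[OF bal, of j] that by auto
      from limU(2)[OF this] have "d j *\<^sub>R (?G *v column j Q + column_weight \<theta> lam mu (d j) *\<^sub>R column j P) = 0"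
        using bal unfolding balanced_svd_column_norms[OF bal]
        by (simp add: balanced_svd_def matrix_vector_mult_scaleR scaleR_add_right mult.commute)
      with that show ?thesis by (simp add: eq_neg_iff_add_eq_0)
    qed
    have GP2: "transpose ?G *v column j P2 = ?c (d j) *\<^sub>R column j Q2" if "d j \<noteq> 0" for j
    proof -
      have "column j Vh' \<noteq> 0" using balanced_svd_column_norms(2)[OF bal', of j] that by auto
      from limV(2)[OF this] have "transpose ?G *v column j Uh' + column_weight \<theta> lam mu (d j) *\<^sub>R column j Vh' = 0"
        unfolding balanced_svd_column_norms[OF bal'] X
        by (simp only: matrix_transpose_mul transpose_transpose)
      moreover have "column j Uh' = d j *\<^sub>R column j P2" "column j Vh' = d j *\<^sub>R column j Q2"
        using bal' by (auto simp: balanced_svd_def)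
      ultimately have "d j *\<^sub>R (transpose ?G *v column j P2 + column_weight \<theta> lam mu (d j) *\<^sub>R column j Q2) = 0"
        by (simp only: matrix_vector_mult_scaleR scaleR_add_right scaleR_scaleR mult.commute)
      with that have "transpose ?G *v column j P2 + column_weight \<theta> lam mu (d j) *\<^sub>R column j Q2 = 0"
        by (simp only: scaleR_eq_0_iff) simp
      then show ?thesis by (simp only: eq_neg_iff_add_eq_0 scaleR_minus_left)
    qed
    have GP: "transpose ?G *v column j P = ?c (d j) *\<^sub>R column j Q" if "d j \<noteq> 0" for j
      by (rule balanced_svd_transfer[OF bal bal' X GP2 that])
    have X': "Vh' ** transpose Uh' = Vb' ** transpose Ub'"
      using X by (metis matrix_transpose_mul transpose_transpose)
    have GQ2: "?G *v column j Q2 = ?c (d j) *\<^sub>R column j P2" if "d j \<noteq> 0" for j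
      by (rule balanced_svd_transfer[OF balanced_svd_swap[OF bal'] balanced_svd_swap[OF bal] X' GQ that])
    have statb: "stationary_point f gf \<theta> lam mu Ub' Vb'"
      by (rule balanced_stationary_point[where f = f and gf = gf, OF th lam f_gradient bal GQ GP])
    have stath: "stationary_point f gf \<theta> lam mu Uh' Vh'"
      by (rule balanced_stationary_point[where f = f and gf = gf, OF th lam f_gradient bal'
            GQ2[unfolded X] GP2[unfolded X]])
    have regVb: "(\<lambda>i. reg \<theta> (Vb (Suc (s i)))) \<longlonglongrightarrow> reg \<theta> Vb'"
      using limU(1) balanced_svd_reg_eq[OF balb] balanced_svd_reg_eq[OF bal] by simp
    have regUh: "(\<lambda>i. reg \<theta> (Uh (Suc (s i)))) \<longlonglongrightarrow> reg \<theta> Uh'"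
      using limV(1) balanced_svd_reg_eq[OF balh] balanced_svd_reg_eq[OF bal'] by simp
    have "?obj Ub' Vb' = \<omega>"
    proof (rule LIMSEQ_unique)
      show "(\<lambda>i. ?obj (Ub (Suc (s i))) (Vb (Suc (s i)))) \<longlonglongrightarrow> ?obj Ub' Vb'"
        by (rule tendsto_objective[OF GDERIV_isCont[OF f_gradient] Ub' Vb' limU(1) regVb])
      show "(\<lambda>i. ?obj (Ub (Suc (s i))) (Vb (Suc (s i)))) \<longlonglongrightarrow> \<omega>"
        using sub'[OF a] by (simp add: a_def)
    qed
    moreover have "?obj Uh' Vh' = \<omega>"
    proof (rule LIMSEQ_unique)
      show "(\<lambda>i. ?obj (Uh (Suc (s i))) (Vh (Suc (s i)))) \<longlonglongrightarrow> ?obj Uh' Vh'"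
        by (rule tendsto_objective[OF GDERIV_isCont[OF f_gradient] Uh' Vh' regUh limV(1)])
      show "(\<lambda>i. ?obj (Uh (Suc (s i))) (Vh (Suc (s i)))) \<longlonglongrightarrow> \<omega>"
        using sub[OF b] by (simp add: b_def)
    qed
    ultimately show ?thesis using statb stath by blast
  qed

  show ?thesis
  proof (intro exI conjI)
    show "(\<lambda>k. Phi f \<theta> lam mu (Ub k) (Vb k)) \<longlonglongrightarrow> ereal \<omega>"
      using a[unfolded a_def[abs_def]] by (simp add: Phi_eq[OF th])
    show "(\<lambda>k. Phi f \<theta> lam mu (Uh (Suc k)) (Vh (Suc k))) \<longlonglongrightarrow> ereal \<omega>"
      using b[unfolded b_def[abs_def]] by (simp add: Phi_eq[OF th])
    show "\<forall>(Uh', Vh', Ub', Vb', Xh', Xb') \<in> cluster_points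
         (\<lambda>k. (Uh (Suc k), Vh (Suc k), Ub (Suc k), Vb (Suc k), Xh (Suc k), Xb (Suc k))).
       stationary_point f gf \<theta> lam mu Ub' Vb' \<and>
       stationary_point f gf \<theta> lam mu Uh' Vh' \<and>
       Phi f \<theta> lam mu Ub' Vb' = ereal \<omega> \<and>
       Phi f \<theta> lam mu Uh' Vh' = ereal \<omega>"
    proof (clarify)
      fix Uh' Vh' Ub' Vb' Xh' Xb'
      assume "(Uh', Vh', Ub', Vb', Xh', Xb') \<in> cluster_points
         (\<lambda>k. (Uh (Suc k), Vh (Suc k), Ub (Suc k), Vb (Suc k), Xh (Suc k), Xb (Suc k)))"
      then obtain s where s: "strict_mono s" and lim: "(\<lambda>i. (Uh (Suc (s i)), Vh (Suc (s i)), Ub (Suc (s i)),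
          Vb (Suc (s i)), Xh (Suc (s i)), Xb (Suc (s i)))) \<longlonglongrightarrow> (Uh', Vh', Ub', Vb', Xh', Xb')"
        by (auto simp: cluster_points_def o_def)
      note lim2 = tendsto_snd[OF lim, simplified]
      note lim3 = tendsto_snd[OF lim2, simplified]
      note lim4 = tendsto_snd[OF lim3, simplified]
      show "stationary_point f gf \<theta> lam mu Ub' Vb' \<and>
       stationary_point f gf \<theta> lam mu Uh' Vh' \<and>
       Phi f \<theta> lam mu Ub' Vb' = ereal \<omega> \<and>
       Phi f \<theta> lam mu Uh' Vh' = ereal \<omega>"
        using cluster[OF s tendsto_fst[OF lim, simplified] tendsto_fst[OF lim2, simplified]
            tendsto_fst[OF lim3, simplified] tendsto_fst[OF lim4, simplified]]
        by (simp add: Phi_eq[OF th])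
    qed
  qed
qed

end
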